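(* Let $K$ be a field of characteristic zero, $S=K[x_0,\ldots,x_n]$, and let $f_0,\ldots,f_n\in S$ be homogeneous polynomials with $\deg f_i=d_i$ such that $f_1,\ldots,f_n$ is a regular sequence in $S$. Put $J=(f_0,\ldots,f_n)$, $B=S/(f_1,\ldots,f_n)$, let $l\in S_1$ be a linear form regular on $B$, put $\tilde W=(l,f_1,\ldots,f_n)$ and $q=\sum_{i=1}^n(d_i-1)$. For an integer $k$ with $0\le k<q$, let (A) denote the assumption $$(f_0)_{d_0+k}\cap\tilde W_{d_0+k}=f_0\tilde W_k .$$ Then: (1) For any integer $p$, the multiplication map $(B/(l))_{p-d_0}\xrightarrow{f_0}(B/(l))_p$ is surjective if and only if the multiplication map $(S/J)_{p-1}\xrightarrow{l}(S/J)_p$ is surjective. If (A) holds for $k$, then these maps are surjective for all $p\ge q-k$. (2) For any integer $r$, if the multiplication map $(B/(l))_r\xrightarrow{f_0}(B/(l))_{r+d_0}$ is injective, then the multiplication map $(S/J)_{r+d_0-1}\xrightarrow{l}(S/J)_{r+d_0}$ is also injective. If (A) holds for $k$, then these maps are injective for all $r\le k$ and for all $r>q$.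
   Context: $S$ has the standard grading; for a graded module (or homogeneous ideal) $M$, $M_p$ denotes its degree $p$ component. $(f_0)$ is the principal ideal generated by $f_0$. A form is regular on a module if it is a nonzerodivisor on it. The $f_i$ have degree exactly $d_i$; in particular they are nonzero. *)

theory Defs
  imports
    "HOL-Library.Cardinality"
    "HOL-Library.Poly_Mapping"
    "HOL-Algebra.Algebraic_Closure_Type"
begin

text \<open>
  Polynomials over \<open>'k\<close> in the variables \<open>'v\<close>: finitely supported coefficient functions on
  exponent vectors, with the convolution product of \<^theory>\<open>HOL-Library.Poly_Mapping\<close>.
  With \<^prop>\<open>CARD('v) = Suc n\<close> the whole type is the ring \<open>K[x\<^sub>0,\<dots>,x\<^sub>n]\<close>.
\<close>
type_synonym ('v, 'k) mpoly = "('v \<Rightarrow>\<^sub>0 nat) \<Rightarrow>\<^sub>0 'k"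

text \<open>The polynomial ring as an object of HOL-Algebra.\<close>
abbreviation PolyRing :: "('v, 'k :: comm_ring_1) mpoly ring" where
  "PolyRing \<equiv> ring_of_type_algebra"

text \<open>
  Degree \<open>p\<close> component \<open>S\<^sub>p\<close> of the standard grading; it contains \<open>0\<close>, and it is \<open>{0}\<close> for
  \<open>p < 0\<close>.
\<close>
definition homog_part :: "int \<Rightarrow> ('v :: finite, 'k :: zero) mpoly set" where
  "homog_part p =
     {g. \<forall>m \<in> Poly_Mapping.keys g. int (\<Sum>v\<in>UNIV. Poly_Mapping.lookup m v) = p}"

text \<open>
  The image of a set \<open>A\<close> in \<open>R/I\<close>. For a homogeneous ideal \<open>I\<close> of a graded ring \<open>R\<close>,
  the degree \<open>p\<close> component of \<open>R/I\<close> is the image of \<open>R\<^sub>p\<close>.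
\<close>
definition quot_image :: "('a, 'b) ring_scheme \<Rightarrow> 'a set \<Rightarrow> 'a set \<Rightarrow> 'a set set" where
  "quot_image R I A = (\<lambda>x. I +>\<^bsub>R\<^esub> x) ` A"

definition nonzerodivisor :: "('a, 'b) ring_scheme \<Rightarrow> 'a \<Rightarrow> bool" where
  "nonzerodivisor R a \<longleftrightarrow>
     a \<in> carrier R \<and> (\<forall>b \<in> carrier R. a \<otimes>\<^bsub>R\<^esub> b = \<zero>\<^bsub>R\<^esub> \<longrightarrow> b = \<zero>\<^bsub>R\<^esub>)"

text \<open>
  \<open>f 1, \<dots>, f n\<close> is a regular sequence in \<open>R\<close>: each \<open>f i\<close> is a nonzerodivisor on
  \<open>R/(f 1, \<dots>, f (i - 1))\<close>, and \<open>R/(f 1, \<dots>, f n)\<close> is not the zero ring.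
\<close>
definition regular_sequence :: "('a, 'b) ring_scheme \<Rightarrow> nat \<Rightarrow> (nat \<Rightarrow> 'a) \<Rightarrow> bool" where
  "regular_sequence R n f \<longleftrightarrow>
     f ` {1..n} \<subseteq> carrier R \<and>
     (\<forall>i \<in> {1..n}. nonzerodivisor (R Quot (Idl\<^bsub>R\<^esub> (f ` {1..<i})))
                     (Idl\<^bsub>R\<^esub> (f ` {1..<i}) +>\<^bsub>R\<^esub> f i)) \<and>
     Idl\<^bsub>R\<^esub> (f ` {1..n}) \<noteq> carrier R"

text \<open>Injectivity and surjectivity of the multiplication map \<open>A \<rightarrow> C, x \<mapsto> a x\<close>,
  for subsets \<open>A\<close> and \<open>C\<close> of \<open>R\<close> with \<open>a A \<subseteq> C\<close>.\<close>
definition mult_surj :: "('a, 'b) ring_scheme \<Rightarrow> 'a \<Rightarrow> 'a set \<Rightarrow> 'a set \<Rightarrow> bool" where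
  "mult_surj R a A C \<longleftrightarrow> (\<lambda>x. a \<otimes>\<^bsub>R\<^esub> x) ` A = C"

definition mult_inj :: "('a, 'b) ring_scheme \<Rightarrow> 'a \<Rightarrow> 'a set \<Rightarrow> bool" where
  "mult_inj R a A \<longleftrightarrow> inj_on (\<lambda>x. a \<otimes>\<^bsub>R\<^esub> x) A"

end

theory Submission
  imports Defs "HOL-Computational_Algebra.Polynomial_FPS"
begin

text \<open>
  The quotient \<open>B/(l)\<close> is \<open>S/W\<close> with \<open>W = (l, f\<^sub>1, \<dots>, f\<^sub>n)\<close> generated by a regular sequence of
  \<open>n + 1\<close> forms in \<open>n + 1\<close> variables, and (A) for \<open>k\<close> says that \<open>f\<^sub>0\<close> is injective on
  \<open>(S/W)\<^sub>k\<close>. The comparison of the two multiplication maps is linear algebra modulo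
  \<open>(f\<^sub>1, \<dots>, f\<^sub>n)\<close>. The remaining claims follow from Gorenstein duality: \<open>(S/W)\<^sub>q\<close> is a line,
  and every nonzero class of lower degree has a nonzero multiple in it.

  The Hilbert series of \<open>S/W\<close> is \<open>\<Prod> (1 + X + \<dots> + X\<^bsup>d - 1\<^esup>)\<close>, so the top degree is \<open>q\<close>. That the
  socle \<open>(W : m)/W\<close> has rank one is Rees' exchange argument: if \<open>g\<close> and \<open>y\<close> are both regular modulo
  \<open>c\<close>, then \<open>y z \<equiv> g w\<close> modulo \<open>c\<close> transfers the socle of \<open>(c, g)\<close> to that of \<open>(c, y)\<close>. After
  adjoining parameters \<open>s\<^sub>j\<close>, the generic linear forms \<open>\<Sum>\<^sub>k s\<^sub>j\<^sup>k x\<^bsub>j+k\<^esub>\<close> are regular by McCoy's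
  argument, they generate the same ideal as the variables, and they can be exchanged one at a time for
  the given sequence. This avoids prime avoidance and Koszul homology.
\<close>

section \<open>Regular elements modulo an ideal\<close>

text \<open>The ring is viewed as a module over itself: \<open>idl.subspace\<close> singles out the
  ideals, \<open>idl.span\<close> is the generated ideal, and the linear algebra of spans becomes
  ideal arithmetic.\<close>

interpretation idl: Modules.module "(*) :: 'a :: comm_ring_1 \<Rightarrow> 'a \<Rightarrow> 'a"
  by unfold_locales (simp_all add: algebra_simps)

declare idl.scale_scale [simp del]

text \<open>Being a nonzerodivisor on the quotient, expressed without cosets. Properness of
  \<open>C\<close> is kept separate: modulo the whole ring every element is regular.\<close>

definition regular_mod :: "'a :: comm_ring_1 set \<Rightarrow> 'a \<Rightarrow> bool" where
  "regular_mod C a \<longleftrightarrow> (\<forall>b. a * b \<in> C \<longrightarrow> b \<in> C)"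

lemma regular_modD: "regular_mod C a \<Longrightarrow> a * b \<in> C \<Longrightarrow> b \<in> C"
  by (simp add: regular_mod_def)

lemma idl_subspace_mult_left: "idl.subspace C \<Longrightarrow> idl.subspace {v. v * u \<in> C}"
  using idl.subspace_0[of C] idl.subspace_add[of C] idl.subspace_scale[of C]
  by (intro idl.subspaceI) (auto simp: distrib_right mult.assoc)

text \<open>Meant for maps that are additive but not linear over the ring: coefficients, shifts of
  exponents, homogeneous components. Hence \<open>gen\<close> tests all multiples of a
  generator.\<close>

lemma additive_span_in:
  fixes P :: "'a :: comm_ring_1 \<Rightarrow> 'b :: comm_ring_1"
  assumes add: "\<And>u v. P (u + v) = P u + P v"
    and C: "idl.subspace C"
    and gen: "\<And>a g. g \<in> G \<Longrightarrow> P (a * g) \<in> C"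
    and u: "u \<in> idl.span G"
  shows "P u \<in> C"
  using u
proof (induction rule: idl.span_induct_alt)
  case base
  have "P 0 = 0" using add[of 0 0] by simp
  then show ?case using idl.subspace_0[OF C] by simp
next
  case (step c x y)
  then show ?case using idl.subspace_add[OF C] gen by (simp add: add)
qed

text \<open>Multiply \<open>a z = k g\<close> by \<open>y\<close> and replace \<open>y z\<close> by
  \<open>g w\<close>: what remains is \<open>g (a w - k y) = 0\<close> modulo \<open>H\<close>, and
  \<open>g\<close> cancels. So whatever kills \<open>z\<close> modulo \<open>(H, g)\<close> kills
  \<open>w\<close> modulo \<open>(H, y)\<close>; if \<open>y\<close> is regular too, the roles can
  be reversed.\<close>

lemma rees_transfer:
  assumes g: "regular_mod (idl.span H) g"
    and w: "y * z - g * w \<in> idl.span H"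
    and az: "a * z \<in> idl.span (insert g H)"
  shows "a * w \<in> idl.span (insert y H)"
proof -
  obtain k where k: "a * z - k * g \<in> idl.span H"
    using az by (auto simp: idl.span_insert)
  have "y * (a * z - k * g) - a * (y * z - g * w) \<in> idl.span H"
    by (intro idl.span_diff idl.span_scale k w)
  moreover have "y * (a * z - k * g) - a * (y * z - g * w) = g * (a * w - k * y)"
    by (simp add: algebra_simps)
  ultimately have "g * (a * w - k * y) \<in> idl.span H" by simp
  then have "a * w - k * y \<in> idl.span H" by (rule regular_modD[OF g])
  then show ?thesis by (auto simp: idl.span_insert)
qed

text \<open>Neighbours in a regular sequence can be exchanged. In a relation
  \<open>g b = w y\<close> modulo \<open>H\<close> the cofactor \<open>w\<close> vanishes modulo
  \<open>(H, g)\<close>, because \<open>y\<close> is regular there; the transfer with multiplier 1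
  then makes \<open>b\<close> vanish modulo \<open>(H, y)\<close>.\<close>

lemma regular_mod_swap:
  assumes g: "regular_mod (idl.span H) g" and y: "regular_mod (idl.span H) y"
    and gy: "regular_mod (idl.span (insert g H)) y"
  shows "regular_mod (idl.span (insert y H)) g"
  unfolding regular_mod_def
proof (intro allI impI)
  fix b assume "g * b \<in> idl.span (insert y H)"
  then obtain w where w: "g * b - w * y \<in> idl.span H"
    by (auto simp: idl.span_insert)
  have "y * w - b * g \<in> idl.span H"
    using idl.span_neg[OF w] by (simp add: algebra_simps)
  then have "y * w \<in> idl.span (insert g H)" by (auto simp: idl.span_insert)
  then have "1 * w \<in> idl.span (insert g H)" using regular_modD[OF gy] by simp
  moreover have "y * w - g * b \<in> idl.span H"
    using idl.span_neg[OF w] by (simp add: algebra_simps)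
  ultimately have "1 * b \<in> idl.span (insert y H)"
    by (rule rees_transfer[OF g, rotated])
  then show "b \<in> idl.span (insert y H)" by simp
qed

text \<open>
  Think of \<open>s\<close> as a polynomial variable; \<open>D\<close> drops the constant coefficient and divides by \<open>s\<close>.
  The proof kills the top coefficient of \<open>u\<close> by multiplying with one coefficient of the form at a time.
\<close>

lemma mccoy_regular:
  fixes s :: "'a :: comm_ring_1" and D :: "'a \<Rightarrow> 'a" and x :: "nat \<Rightarrow> 'a"
  assumes C: "idl.subspace C"
    and D_add: "\<And>u v. D (u + v) = D u + D v"
    and D_s: "\<And>u. D (s * u) = u"
    and D_x: "\<And>k u. D (x k * u) = x k * D u"
    and nil: "\<And>u. \<exists>d. (D ^^ d) u = 0"
    and DC: "\<And>u. u \<in> C \<Longrightarrow> D u \<in> C"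
    and ann: "\<And>u. (\<And>k. k \<le> N \<Longrightarrow> x k * u \<in> C) \<Longrightarrow> u \<in> C"
  shows "regular_mod C (\<Sum>k<Suc N. s ^ k * x k)"
proof -
  define Y where "Y i = (\<Sum>k<i. s ^ k * x k)" for i
  have D0: "D 0 = 0" using D_add[of 0 0] by simp
  have Dm_add: "(D ^^ m) (u + v) = (D ^^ m) u + (D ^^ m) v" for m u v
    by (induction m) (auto simp: D_add)
  have Dm0: "(D ^^ m) 0 = 0" for m by (induction m) (auto simp: D0)
  have Dm_diff: "(D ^^ m) (u - v) = (D ^^ m) u - (D ^^ m) v" for m u v
    using Dm_add[of m "u - v" v] by simp
  have Dm_sum: "(D ^^ m) (\<Sum>k<i. h k) = (\<Sum>k<i. (D ^^ m) (h k))" for m and i :: nat and h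
    by (induction i) (auto simp: Dm_add Dm0)
  have Dm_x: "(D ^^ m) (x k * u) = x k * (D ^^ m) u" for m k u
    by (induction m) (auto simp: D_x)
  have Dm_s: "(D ^^ (m + k)) (s ^ k * u) = (D ^^ m) u" for m k u
  proof (induction k)
    case (Suc k)
    have "(D ^^ (m + Suc k)) (s ^ Suc k * u) = (D ^^ (m + k)) (D (s * (s ^ k * u)))"
      by (simp add: funpow_Suc_right mult.assoc del: funpow.simps)
    then show ?case using Suc by (simp add: D_s)
  qed simp
  have Dm_C: "u \<in> C \<Longrightarrow> (D ^^ m) u \<in> C" for m u
    by (induction m) (auto simp: DC)
  have D_ge: "(D ^^ m) u = 0" if "(D ^^ d) u = 0" "d \<le> m" for m d u
    proof -
    have "(D ^^ m) u = (D ^^ (m - d)) ((D ^^ d) u)"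
      using funpow_add[of "m - d" d D] that(2) by (simp add: fun_eq_iff)
    then show ?thesis by (simp add: that Dm0)
  qed
  \<comment> \<open>Induction on a strict bound \<open>d\<close> for the degree of \<open>u\<close>
    in \<open>s\<close>.\<close>
  have main: "u \<in> C" if "(D ^^ d) u = 0" "Y (Suc N) * u \<in> C" for d u
    using that
  proof (induction d arbitrary: u)
    case 0
    then show ?case using idl.subspace_0[OF C] by simp
  next
    case (Suc d)
    \<comment> \<open>The coefficient of \<open>s ^ d\<close>, the highest one that can be
      nonzero.\<close>
    define c where "c = (D ^^ d) u"
    \<comment> \<open>If only the terms up to \<open>i\<close> are left in the form, the top
      coefficient of the product is \<open>x i * c\<close>. Terms with \<open>k < i\<close> do not
      reach it, since \<open>i + d - k\<close> then exceeds \<open>d\<close>. Hence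
      \<open>x i * u\<close> may be replaced by \<open>x i * u'\<close>, which has smaller degree
      and is still killed by the full form.\<close>
    have xu: "x i * u \<in> C" if i: "i \<le> N" and Yi: "Y (Suc i) * u \<in> C" for i
    proof -
      have "(D ^^ (i + d)) (s ^ k * x k * u) = (if k = i then x i * c else 0)" if "k < Suc i" for k
      proof -
        have "(D ^^ (i + d)) (s ^ k * x k * u) = (D ^^ ((i + d - k) + k)) (s ^ k * (x k * u))"
          using that by (simp add: mult.assoc)
        also have "\<dots> = x k * (D ^^ (i + d - k)) u" by (simp add: Dm_s Dm_x)
        also have "\<dots> = (if k = i then x i * c else 0)"
          using that D_ge[OF Suc.prems(1), of "i + d - k"] by (auto simp: c_def)
        finally show ?thesis .
      qed
      then have "(D ^^ (i + d)) (Y (Suc i) * u) = (\<Sum>k<Suc i. if k = i then x i * c else 0)"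
        unfolding Y_def sum_distrib_right Dm_sum by (intro sum.cong) auto
      also have "\<dots> = x i * c" by (subst sum.delta) auto
      finally have xc: "x i * c \<in> C" using Dm_C[OF Yi] by metis
      define u' where "u' = u - s ^ d * c"
      have "(D ^^ d) (s ^ d * c) = c" using Dm_s[of 0 d c] by simp
      then have "(D ^^ d) (x i * u') = 0"
        by (simp add: Dm_x u'_def Dm_diff c_def)
      moreover have "x i * (Y (Suc N) * u) - (s ^ d * Y (Suc N)) * (x i * c) \<in> C"
        by (intro idl.subspace_diff idl.subspace_scale C Suc.prems xc)
      then have "Y (Suc N) * (x i * u') \<in> C"
        by (simp add: u'_def algebra_simps)
      ultimately have "x i * u' \<in> C" by (rule Suc.IH)
      then have "x i * u' + s ^ d * (x i * c) \<in> C"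
        using idl.subspace_add[OF C] idl.subspace_scale[OF C xc] by blast
      then show "x i * u \<in> C" by (simp add: u'_def algebra_simps)
    qed
    \<comment> \<open>Downward induction: \<open>x i * u\<close> now lies in \<open>C\<close>, so
      the last term of the form can be removed.\<close>
    have Y: "Y i * u \<in> C" if "i \<le> Suc N" for i
      using that
    proof (induction rule: inc_induct)
      case base
      show ?case by (rule Suc.prems)
    next
      case (step i)
      have "Y (Suc i) * u - s ^ i * (x i * u) \<in> C"
        using step by (intro idl.subspace_diff[OF C] idl.subspace_scale[OF C xu]) auto
      then show ?case by (simp add: Y_def algebra_simps)
    qed
    show ?case by (rule ann) (auto intro!: xu Y)
  qed
  show ?thesis
    using main nil unfolding regular_mod_def Y_def by blast
qed

section \<open>Polynomials in generic parameters\<close>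

lemma sum_single_keys:
  "(\<Sum>m\<in>Poly_Mapping.keys p. Poly_Mapping.single m (Poly_Mapping.lookup p m)) = p"
  by (rule poly_mapping_eqI)
     (auto simp: lookup_sum lookup_single when_def in_keys_iff)

lemma poly_mapping_induct_single [case_names zero single add]:
  fixes p :: "'a \<Rightarrow>\<^sub>0 'b :: comm_monoid_add"
  assumes "P 0" "\<And>m c. P (Poly_Mapping.single m c)" "\<And>p q. P p \<Longrightarrow> P q \<Longrightarrow> P (p + q)"
  shows "P p"
proof -
  have "P (\<Sum>m\<in>M. Poly_Mapping.single m (Poly_Mapping.lookup p m))" if "finite M" for M
    using that by induction (auto intro: assms)
  then show ?thesis using sum_single_keys[of p] by (metis finite_keys)
qed

lemma lookup_single_mult_add:
  fixes p :: "'a :: cancel_comm_monoid_add \<Rightarrow>\<^sub>0 'b :: comm_ring_1"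
  shows "Poly_Mapping.lookup (Poly_Mapping.single k c * p) (k + m) = c * Poly_Mapping.lookup p m"
  by (induction p rule: poly_mapping_induct_single)
     (auto simp: mult_single lookup_single when_def distrib_left lookup_add)

lemma lookup_single_0_mult:
  fixes p :: "'a :: cancel_comm_monoid_add \<Rightarrow>\<^sub>0 'b :: comm_ring_1"
  shows "Poly_Mapping.lookup (Poly_Mapping.single 0 c * p) m = c * Poly_Mapping.lookup p m"
  using lookup_single_mult_add[of 0 c p m] by simp

text \<open>Coefficients in \<open>'a\<close>, later the polynomial ring itself, and parameters
  indexed by all naturals, so that the number of generic forms needs no type of its own.\<close>

type_synonym 'a gen = "(nat \<Rightarrow>\<^sub>0 nat) \<Rightarrow>\<^sub>0 'a"

abbreviation const :: "'a \<Rightarrow> 'a :: comm_ring_1 gen" where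
  "const \<equiv> Poly_Mapping.single 0"

definition indet :: "nat \<Rightarrow> 'a :: comm_ring_1 gen" where
  "indet j = Poly_Mapping.single (Poly_Mapping.single j 1) 1"

text \<open>The operator \<open>D\<close> of \<open>mccoy_regular\<close> for parameter
  \<open>j\<close>: pulling back along multiplication by the parameter discards the monomials
  without it and divides the others by it.\<close>

definition unshift :: "nat \<Rightarrow> 'a :: comm_ring_1 gen \<Rightarrow> 'a gen" where
  "unshift j = Poly_Mapping.map_key ((+) (Poly_Mapping.single j 1))"

lemma lookup_unshift:
  "Poly_Mapping.lookup (unshift j p) m = Poly_Mapping.lookup p (Poly_Mapping.single j 1 + m)"
  by (simp add: unshift_def map_key.rep_eq)

lemma unshift_add: "unshift j (p + q) = unshift j p + unshift j q"
  by (simp add: unshift_def map_key_plus)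

lemma unshift_0 [simp]: "unshift j 0 = 0"
  by (simp add: unshift_def)

lemma unshift_indet: "unshift j (indet j * p) = p"
  by (rule poly_mapping_eqI) (simp add: lookup_unshift indet_def lookup_single_mult_add)

text \<open>A monomial \<open>k\<close> free of parameter \<open>j\<close> does not affect whether
  \<open>m\<close> is divisible by that parameter, so the shift treats it as a constant.\<close>

lemma unshift_single_mult:
  assumes k: "Poly_Mapping.lookup k j = 0"
  shows "unshift j (Poly_Mapping.single k c * p) = Poly_Mapping.single k c * unshift j p"
proof (induction p rule: poly_mapping_induct_single)
  case (single m a)
  let ?e = "Poly_Mapping.single j (1 :: nat)"
  show ?case
  proof (cases "Poly_Mapping.lookup m j = 0")
    case True
    then have a: "k + m \<noteq> ?e + m'" and b: "m \<noteq> ?e + m'" for m'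
      using k by (metis One_nat_def add_is_0 lookup_add lookup_single_eq nat.distinct(1))+
    then have "unshift j (Poly_Mapping.single (k + m) (c * a)) = 0" "unshift j (Poly_Mapping.single m a) = 0"
      by (auto intro!: poly_mapping_eqI
          simp: lookup_unshift lookup_single_not_eq[OF a] lookup_single_not_eq[OF b]
          simp del: One_nat_def)
    then show ?thesis by (simp add: mult_single)
  next
    case False
    define m' where "m' = m - ?e"
    have m: "m = ?e + m'"
      using False by (intro poly_mapping_eqI) (auto simp: m'_def lookup_add lookup_minus lookup_single when_def)
    have "unshift j (Poly_Mapping.single (?e + i) b) = Poly_Mapping.single i b" for i and b :: 'a
      unfolding unshift_def by (rule map_key_single) simp
    then show ?thesis unfolding m by (simp add: mult_single add.left_commute[of k] del: One_nat_def)
  qed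
qed (auto simp: distrib_left unshift_add)

lemma unshift_power_0: "\<exists>d. (unshift j ^^ d) p = 0"
proof -
  let ?e = "Poly_Mapping.single j (1 :: nat)"
  have *: "Poly_Mapping.lookup ((unshift j ^^ d) p) m = Poly_Mapping.lookup p (Poly_Mapping.single j d + m)"
    for d m and p :: "'a gen"
  proof (induction d arbitrary: m)
    case (Suc d)
    then show ?case by (simp add: lookup_unshift flip: add.assoc single_add)
  qed simp
  \<comment> \<open>One more than the degree of \<open>p\<close> in parameter
    \<open>j\<close>.\<close>
  define d where "d = Suc (Max ((\<lambda>m. Poly_Mapping.lookup m j) ` Poly_Mapping.keys p))"
  have "Poly_Mapping.single j d + m \<notin> Poly_Mapping.keys p" for m
  proof
    assume "Poly_Mapping.single j d + m \<in> Poly_Mapping.keys p"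
    then have "Poly_Mapping.lookup (Poly_Mapping.single j d + m) j
        \<le> Max ((\<lambda>m. Poly_Mapping.lookup m j) ` Poly_Mapping.keys p)"
      by (intro Max_ge) auto
    then show False by (simp add: lookup_add d_def)
  qed
  then have "(unshift j ^^ d) p = 0"
    by (intro poly_mapping_eqI) (simp add: * in_keys_iff)
  then show ?thesis by blast
qed

text \<open>Extension of an ideal to the parameter ring is coefficientwise. This lifts regularity
  and socle conditions to the parameters and brings conclusions back through a single
  coefficient.\<close>

lemma in_span_const_iff:
  "u \<in> idl.span (const ` G) \<longleftrightarrow> (\<forall>m. Poly_Mapping.lookup u m \<in> idl.span G)"
proof safe
  fix m assume u: "u \<in> idl.span (const ` G)"
  show "Poly_Mapping.lookup u m \<in> idl.span G"
  proof (rule additive_span_in[OF _ _ _ u, where P = "\<lambda>u. Poly_Mapping.lookup u m"])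
    fix a g assume "g \<in> const ` G"
    then obtain g' where "g = const g'" "g' \<in> G" by blast
    then show "Poly_Mapping.lookup (a * g) m \<in> idl.span G"
      by (subst mult.commute) (simp add: lookup_single_0_mult mult.commute[of g'] idl.span_scale idl.span_base)
  qed (auto simp: lookup_add)
next
  assume u: "\<forall>m. Poly_Mapping.lookup u m \<in> idl.span G"
  have "Poly_Mapping.single m a \<in> idl.span (const ` G)" if a: "a \<in> idl.span G" for m a
  proof (rule additive_span_in[OF _ _ _ a, where P = "Poly_Mapping.single m"])
    fix b g assume "g \<in> G"
    then have "Poly_Mapping.single m b * const g \<in> idl.span (const ` G)"
      by (intro idl.span_scale idl.span_base) auto
    then show "Poly_Mapping.single m (b * g) \<in> idl.span (const ` G)"
      by (simp add: mult_single)
  qed (auto simp: single_add)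
  then have "(\<Sum>m\<in>Poly_Mapping.keys u. Poly_Mapping.single m (Poly_Mapping.lookup u m)) \<in> idl.span (const ` G)"
    using u by (intro idl.span_sum) auto
  then show "u \<in> idl.span (const ` G)" by (simp only: sum_single_keys)
qed

section \<open>The socle modulo a regular sequence\<close>

text \<open>
  Being unitriangular in the \<open>x\<close>, the generic forms generate the same ideal as the \<open>x\<close>.
\<close>

definition generic_form :: "nat \<Rightarrow> (nat \<Rightarrow> 'a :: comm_ring_1) \<Rightarrow> nat \<Rightarrow> 'a gen" where
  "generic_form N x j = (\<Sum>k<N - j. indet j ^ k * const (x (j + k)))"

lemma unshift_const: "unshift j (const a * u) = const a * unshift j u"
  by (rule unshift_single_mult) simp

text \<open>Each form has a parameter of its own, so the other forms are constants for the shift;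
  ideals containing them remain stable under it.\<close>

lemma unshift_generic_form:
  assumes "i \<noteq> j"
  shows "unshift j (generic_form N x i * u) = generic_form N x i * unshift j u"
proof -
  have indet: "unshift j (indet i * u) = indet i * unshift j u" for u :: "'a gen"
    unfolding indet_def using assms by (intro unshift_single_mult) (simp add: lookup_single)
  have pow: "unshift j (indet i ^ k * u) = indet i ^ k * unshift j u" for k and u :: "'a gen"
    by (induction k arbitrary: u) (simp_all add: indet mult.assoc)
  have "unshift j ((\<Sum>k<m. indet i ^ k * const (x (i + k))) * u)
      = (\<Sum>k<m. indet i ^ k * const (x (i + k))) * unshift j u" for m :: nat
    by (induction m) (simp_all add: distrib_right unshift_add pow unshift_const mult.assoc)
  then show ?thesis by (simp add: generic_form_def)
qed

text \<open>Back substitution: the form with index \<open>m\<close> is \<open>x m\<close> plus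
  multiples of later \<open>x\<close>, so the induction runs from large \<open>m\<close> downwards.
  The factor \<open>u\<close> allows both annihilators and, with \<open>u = 1\<close>, plain
  membership.\<close>

lemma generic_form_triangular:
  assumes C: "idl.subspace C" and jN: "j \<le> N"
    and y: "\<And>i. i < j \<Longrightarrow> generic_form N x i * u \<in> C"
    and x: "\<And>i. j \<le> i \<Longrightarrow> i < N \<Longrightarrow> const (x i) * u \<in> C"
    and m: "m < N"
  shows "const (x m) * u \<in> C"
  using m
proof (induction "N - m" arbitrary: m rule: less_induct)
  case less
  show ?case
  proof (cases "j \<le> m")
    case False
    obtain r where r: "N - m = Suc r" using less.prems by (cases "N - m") auto
    have eq: "generic_form N x m
        = const (x m) + (\<Sum>k<r. indet m ^ Suc k * const (x (m + Suc k)))"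
      by (simp only: generic_form_def r sum.lessThan_Suc_shift) simp
    have "(\<Sum>k<r. indet m ^ Suc k * (const (x (m + Suc k)) * u)) \<in> C"
      using r by (intro idl.subspace_sum[OF C] idl.subspace_scale[OF C] less.hyps) auto
    with y[of m] False
    have "generic_form N x m * u - (\<Sum>k<r. indet m ^ Suc k * (const (x (m + Suc k)) * u)) \<in> C"
      by (intro idl.subspace_diff[OF C]) auto
    then show ?thesis
      by (simp add: eq distrib_right sum_distrib_right mult.assoc del: power_Suc)
  qed (use x less.prems in auto)
qed

lemma generic_form_mult_in:
  assumes C: "idl.subspace C" and x: "\<And>i. i < N \<Longrightarrow> const (x i) * u \<in> C"
  shows "generic_form N x j * u \<in> C"
  unfolding generic_form_def sum_distrib_right mult.assoc
  by (intro idl.subspace_sum[OF C] idl.subspace_scale[OF C] x) auto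

section \<open>Exchanging a regular sequence for generic linear combinations\<close>

context
  fixes N :: nat and x g :: "nat \<Rightarrow> 'a :: comm_ring_1"
  assumes g_in: "\<And>i. i < N \<Longrightarrow> g i \<in> idl.span (x ` {..<N})"
    and g_reg: "\<And>i. i < N \<Longrightarrow> regular_mod (idl.span (g ` {..<i})) (g i)"
begin

text \<open>The intermediate sequences. The socle is transported along \<open>i + j = N\<close>,
  from the given sequence at \<open>j = 0\<close> to the generic forms at
  \<open>j = N\<close>.\<close>

abbreviation mixed :: "nat \<Rightarrow> nat \<Rightarrow> 'a gen set" where
  "mixed j i \<equiv> generic_form N x ` {..<j} \<union> const ` g ` {..<i}"

lemma mixed_Suc_left: "mixed (Suc j) i = insert (generic_form N x j) (mixed j i)"
  by (auto simp: lessThan_Suc)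

lemma mixed_Suc_right: "mixed j (Suc i) = insert (const (g i)) (mixed j i)"
  by (auto simp: lessThan_Suc)

text \<open>McCoy's argument reduces the claim to elements \<open>u\<close> with
  \<open>x j * u\<close>, ..., \<open>x (N - 1) * u\<close> in the ideal. The earlier forms already
  lie in it, so by triangularity every \<open>x m * u\<close> does, hence also
  \<open>g i * u\<close>, and \<open>g i\<close> is regular.\<close>

lemma generic_form_regular:
  assumes j: "j < N" and g: "regular_mod (idl.span (mixed j i)) (const (g i))" and i: "i < N"
  shows "regular_mod (idl.span (mixed j i)) (generic_form N x j)"
proof -
  let ?C = "idl.span (mixed j i)"
  obtain r where r: "N - j = Suc r" using j by (cases "N - j") auto
  have "regular_mod ?C (\<Sum>k<Suc r. indet j ^ k * const (x (j + k)))"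
  proof (rule mccoy_regular[where D = "unshift j"])
    show "\<exists>d. (unshift j ^^ d) u = 0" for u :: "'a gen" by (rule unshift_power_0)
    fix u :: "'a gen"
    show "u \<in> ?C \<Longrightarrow> unshift j u \<in> ?C"
    proof (rule additive_span_in[where P = "unshift j"])
      fix a h assume h: "h \<in> mixed j i"
      then have "unshift j (h * a) = h * unshift j a"
        by (auto simp: unshift_const unshift_generic_form)
      then have "unshift j (a * h) = unshift j a * h" by (simp add: mult.commute)
      then show "unshift j (a * h) \<in> ?C"
        using idl.span_scale[OF idl.span_base[OF h]] by simp
    qed (auto simp: unshift_add)
    assume xk: "\<And>k. k \<le> r \<Longrightarrow> const (x (j + k)) * u \<in> ?C"
    have x: "const (x m) * u \<in> ?C" if "j \<le> m" "m < N" for m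
      using xk[of "m - j"] that r by auto
    have y: "generic_form N x m * u \<in> ?C" if "m < j" for m
      using that by (subst mult.commute, intro idl.span_scale idl.span_base) auto
    have "const (x m) * u \<in> ?C" if "m < N" for m
      using generic_form_triangular[OF idl.subspace_span less_imp_le[OF j] y x that] .
    then have "idl.span (const ` x ` {..<N}) \<subseteq> {v. v * u \<in> ?C}"
      by (intro idl.span_minimal idl_subspace_mult_left) auto
    moreover have "const (g i) \<in> idl.span (const ` x ` {..<N})"
      using g_in[OF i] by (auto simp: in_span_const_iff lookup_single when_def idl.span_zero)
    ultimately show "u \<in> ?C" using regular_modD[OF g] by blast
  qed (auto simp: unshift_add unshift_indet unshift_const)
  then show ?thesis by (simp add: generic_form_def r)
qed

text \<open>Induction on \<open>j\<close>: the next generic form is regular both before and after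
  \<open>g i\<close> is adjoined, so the two can be swapped. The case after \<open>g i\<close> uses
  regularity of \<open>g (Suc i)\<close>, which the bound on \<open>i + j\<close> provides.\<close>

lemma mixed_regular:
  assumes "i + j < N"
  shows "regular_mod (idl.span (mixed j i)) (const (g i))"
  using assms
proof (induction j arbitrary: i)
  case 0
  have "const (g i) * b \<in> idl.span (const ` g ` {..<i}) \<Longrightarrow> b \<in> idl.span (const ` g ` {..<i})" for b
    using regular_modD[OF g_reg[of i]] 0 by (simp add: in_span_const_iff lookup_single_0_mult)
  then show ?case by (simp add: regular_mod_def)
next
  case (Suc j)
  have g: "regular_mod (idl.span (mixed j i)) (const (g i))"
    "regular_mod (idl.span (mixed j (Suc i))) (const (g (Suc i)))"
    using Suc by auto
  have y: "regular_mod (idl.span (mixed j i)) (generic_form N x j)"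
    "regular_mod (idl.span (mixed j (Suc i))) (generic_form N x j)"
    using Suc.prems by (auto intro: generic_form_regular g)
  show ?case
    using regular_mod_swap[OF g(1) y(1)] y(2) unfolding mixed_Suc_left mixed_Suc_right by blast
qed

text \<open>Descent from \<open>j = N\<close>, where \<open>p = z\<close> and \<open>p' = z'\<close>
  give the trivial relation and \<open>z\<close> itself lies outside the ideal. Each step sends
  socle elements one place forward, takes the relation found there, and pulls it back.\<close>

lemma socle_rank_one_mixed:
  assumes "j \<le> N"
    and "\<And>k. k < N \<Longrightarrow> const (x k) * z \<in> idl.span (mixed j (N - j))"
    and "\<And>k. k < N \<Longrightarrow> const (x k) * z' \<in> idl.span (mixed j (N - j))"
    and "z \<notin> idl.span (mixed j (N - j))"
  shows "\<exists>p p'. p \<notin> idl.span (mixed N 0) \<and> p' * z - p * z' \<in> idl.span (mixed j (N - j))"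
  using assms
proof (induction arbitrary: z z' rule: inc_induct)
  case base
  have "z' * z - z * z' = 0" by simp
  then have *: "z' * z - z * z' \<in> idl.span (mixed N (N - N))" by (simp only: idl.span_zero)
  show ?case
    using base(3) by (intro exI[of _ z] exI[of _ z'] conjI *) simp
next
  case (step j)
  define i where "i = N - Suc j"
  have i: "N - j = Suc i" "N - Suc j = i" "i + j < N" "i < N"
    using step.hyps by (auto simp: i_def)
  let ?C = "idl.span (mixed j i)" and ?g = "const (g i)" and ?y = "generic_form N x j"
  have g: "regular_mod ?C ?g" using i by (intro mixed_regular) auto
  have y: "regular_mod ?C ?y" using g i step.hyps by (intro generic_form_regular) auto
  \<comment> \<open>The generic form combines the \<open>x\<close>, so it sends a socle element into
    the ideal with \<open>g i\<close> adjoined. The cofactor \<open>w\<close> of \<open>g i\<close>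
    is the corresponding socle element after the exchange.\<close>
  have ex: "\<exists>w. ?y * u - ?g * w \<in> ?C"
    if "\<And>k. k < N \<Longrightarrow> const (x k) * u \<in> idl.span (mixed j (N - j))" for u
  proof -
    have "?y * u \<in> idl.span (insert ?g (mixed j i))"
      using that unfolding i mixed_Suc_right by (rule generic_form_mult_in[OF idl.subspace_span])
    then obtain k where "?y * u - k * ?g \<in> ?C" by (auto simp: idl.span_insert)
    then show ?thesis by (auto simp: mult.commute)
  qed
  obtain w where w: "?y * z - ?g * w \<in> ?C" using ex[OF step.prems(1)] by auto
  obtain w' where w': "?y * z' - ?g * w' \<in> ?C" using ex[OF step.prems(2)] by auto
  have to: "a * v \<in> idl.span (mixed (Suc j) i)"
    if "?y * u - ?g * v \<in> ?C" "a * u \<in> idl.span (mixed j (N - j))" for a u v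
    using rees_transfer[OF g that(1), of a] that(2)
    by (simp only: i mixed_Suc_left mixed_Suc_right)
  \<comment> \<open>The Rees transfer in the opposite direction with multiplier 1: if the image
    vanishes, so does the original element.\<close>
  have fro: "u \<in> idl.span (mixed j (N - j))"
    if "?y * u - ?g * v \<in> ?C" "v \<in> idl.span (mixed (Suc j) i)" for u v
    using rees_transfer[OF y, of ?g v u 1] that idl.span_neg[OF that(1)]
    by (simp only: i mixed_Suc_left mixed_Suc_right) simp
  have "\<exists>p p'. p \<notin> idl.span (mixed N 0) \<and> p' * w - p * w' \<in> idl.span (mixed (Suc j) (N - Suc j))"
  proof (rule step.IH)
    show "const (x k) * w \<in> idl.span (mixed (Suc j) (N - Suc j))" if "k < N" for k
      unfolding i(2) by (rule to[OF w step.prems(1)[OF that]])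
    show "const (x k) * w' \<in> idl.span (mixed (Suc j) (N - Suc j))" if "k < N" for k
      unfolding i(2) by (rule to[OF w' step.prems(2)[OF that]])
    show "w \<notin> idl.span (mixed (Suc j) (N - Suc j))"
      unfolding i(2) using fro[OF w] step.prems(3) by blast
  qed
  then obtain p p' where p: "p \<notin> idl.span (mixed N 0)" "p' * w - p * w' \<in> idl.span (mixed (Suc j) i)"
    unfolding i(2) by blast
  \<comment> \<open>The exchange relation is linear, so it links the two combinations with
    coefficients \<open>p'\<close> and \<open>p\<close> as well.\<close>
  have "p' * (?y * z - ?g * w) - p * (?y * z' - ?g * w') \<in> ?C"
    by (intro idl.span_diff idl.span_scale w w')
  then have "?y * (p' * z - p * z') - ?g * (p' * w - p * w') \<in> ?C"
    by (simp add: algebra_simps)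
  from fro[OF this p(2)] p(1) show ?case by blast
qed

text \<open>When the \<open>x\<close> are the variables, \<open>a\<close> has a nonzero constant
  term and acts on the socle like a nonzero scalar; the relation then makes \<open>z'\<close> a
  scalar multiple of \<open>z\<close>.\<close>

theorem socle_rank_one:
  assumes z: "\<And>k. k < N \<Longrightarrow> x k * z \<in> idl.span (g ` {..<N})"
    and z': "\<And>k. k < N \<Longrightarrow> x k * z' \<in> idl.span (g ` {..<N})"
    and nz: "z \<notin> idl.span (g ` {..<N})"
  shows "\<exists>a b. a \<notin> idl.span (x ` {..<N}) \<and> b * z - a * z' \<in> idl.span (g ` {..<N})"
proof -
  have const_in: "const u \<in> idl.span (const ` G) \<longleftrightarrow> u \<in> idl.span G" for u :: 'a and G
    by (auto simp: in_span_const_iff lookup_single when_def idl.span_zero)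
  have "\<exists>p p'. p \<notin> idl.span (mixed N 0) \<and> p' * const z - p * const z' \<in> idl.span (mixed 0 (N - 0))"
    using assms by (intro socle_rank_one_mixed) (auto simp: mult_single const_in)
  then obtain p p' where p: "p \<notin> idl.span (mixed N 0)"
    and pz: "p' * const z - p * const z' \<in> idl.span (const ` g ` {..<N})" by auto
  have "const (x m) * 1 \<in> idl.span (mixed N 0)" if "m < N" for m
    by (rule generic_form_triangular[OF idl.subspace_span order_refl _ _ that])
       (auto intro: idl.span_base)
  then have "idl.span (const ` x ` {..<N}) \<subseteq> idl.span (mixed N 0)"
    by (intro idl.span_minimal) auto
  \<comment> \<open>The generic forms generate the extension of \<open>(x)\<close>, so some
    coefficient of \<open>p\<close> lies outside \<open>(x)\<close>. As \<open>z\<close> and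
    \<open>z'\<close> are constant, comparing this coefficient descends the relation.\<close>
  with p obtain m where m: "Poly_Mapping.lookup p m \<notin> idl.span (x ` {..<N})"
    using in_span_const_iff[of p "x ` {..<N}"] by blast
  have c: "Poly_Mapping.lookup (v * const a) m = Poly_Mapping.lookup v m * a" for v and a :: 'a
    using lookup_single_0_mult[of a v m] by (simp add: mult.commute)
  have "Poly_Mapping.lookup (p' * const z - p * const z') m \<in> idl.span (g ` {..<N})"
    using pz by (simp only: in_span_const_iff)
  then have "Poly_Mapping.lookup p' m * z - Poly_Mapping.lookup p m * z' \<in> idl.span (g ` {..<N})"
    by (simp only: lookup_minus c)
  with m show ?thesis by blast
qed

end

section \<open>Dimension counts and the grading\<close>

text \<open>Rank and nullity for the map that \<open>f\<close> induces from \<open>V\<close> to the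
  quotient by \<open>U\<close>, whose kernel is \<open>K\<close>. Extending a basis
  \<open>B0\<close> of \<open>K\<close> to a basis \<open>B1\<close> of \<open>V\<close> and adding
  \<open>f (B1 - B0)\<close> to a basis of \<open>U\<close> gives a basis of the sum. The formula
  avoids subtraction of naturals.\<close>

lemma (in Vector_Spaces.vector_space) dim_add_image:
  assumes U: "subspace U" and V: "subspace V" and K: "subspace K" "K \<subseteq> V"
    and f: "Vector_Spaces.linear scale scale f"
    and kernel: "\<And>v. v \<in> V \<Longrightarrow> f v \<in> U \<longleftrightarrow> v \<in> K"
    and fin: "finite F" "V \<subseteq> span F"
    and finU: "finite G" "U \<subseteq> span G"
  shows "dim {u + f v |u v. u \<in> U \<and> v \<in> V} + dim K = dim U + dim V"
proof -
  interpret f: Vector_Spaces.linear scale scale f by (rule f)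
  obtain A where A: "A \<subseteq> U" "independent A" "U \<subseteq> span A" "card A = dim U"
    by (rule basis_exists)
  obtain B0 where B0: "B0 \<subseteq> K" "independent B0" "K \<subseteq> span B0" "card B0 = dim K"
    by (rule basis_exists)
  obtain B1 where B1: "B0 \<subseteq> B1" "B1 \<subseteq> V" "independent B1" "V \<subseteq> span B1"
    using maximal_independent_subset_extend[of B0 V] B0 K by blast
  have finA: "finite A"
    using independent_span_bound[OF finU(1) A(2)] A(1) finU(2) by blast
  have finB: "finite B1"
    using independent_span_bound[OF fin(1) B1(3)] B1(2) fin(2) by blast
  have sA: "span A = U" and sB0: "span B0 = K" and sB1: "span B1 = V"
    using span_subspace[OF A(1,3) U] span_subspace[OF B0(1,3) K(1)] span_subspace[OF B1(2,4) V]
    by simp_all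
  define D where "D = B1 - B0"
  have indep: "independent (A \<union> f ` E) \<and> card (A \<union> f ` E) = card A + card E"
    if "finite E" "E \<subseteq> D" for E
    using that
  proof (induction E rule: finite_induct)
    case (insert b E)
    \<comment> \<open>Otherwise \<open>b - d\<close> lies in the kernel \<open>K\<close> for some
      \<open>d\<close> in the span of \<open>E\<close>, contradicting independence of
      \<open>B1\<close>. Adding vectors one at a time also shows that \<open>f\<close> does not
      collapse \<open>D\<close>.\<close>
    have "f b \<notin> span (A \<union> f ` E)"
    proof
      assume "f b \<in> span (A \<union> f ` E)"
      then obtain u w where u: "u \<in> span A" and w: "w \<in> span (f ` E)" and b: "f b = u + w"
        by (auto simp: span_Un)
      then obtain d where d: "d \<in> span E" "w = f d" by (auto simp: f.span_image)
      have "E \<subseteq> V" "b \<in> V" using insert.prems B1 by (auto simp: D_def)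
      then have "d \<in> V" using d span_minimal[OF _ V] by blast
      have "f (b - d) = u" using b d by (simp add: f.diff)
      then have "f (b - d) \<in> U" using u sA by simp
      then have "b - d \<in> span B0"
        using kernel[of "b - d"] V \<open>b \<in> V\<close> \<open>d \<in> V\<close> by (simp add: subspace_diff sB0)
      moreover have "B0 \<subseteq> B1 - {b}" "E \<subseteq> B1 - {b}"
        using insert.prems insert.hyps B1(1) by (auto simp: D_def)
      ultimately have "(b - d) + d \<in> span (B1 - {b})"
        using d(1) by (meson span_add span_mono subsetD)
      then show False
        using B1(3) insert.prems by (auto simp: dependent_def D_def)
    qed
    moreover from this have "f b \<notin> A \<union> f ` E" using span_superset by (rule contra_subsetD[rotated])
    ultimately show ?case
      using insert finA independent_insertI[of "f b" "A \<union> f ` E"] by simp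
  qed (use A in auto)
  have "dim {u + f v |u v. u \<in> U \<and> v \<in> V} = card A + card D"
  proof (rule dim_unique)
    show "independent (A \<union> f ` D)" "card (A \<union> f ` D) = card A + card D"
      using indep[of D] finB by (auto simp: D_def)
    show "A \<union> f ` D \<subseteq> {u + f v |u v. u \<in> U \<and> v \<in> V}"
    proof
      fix a assume "a \<in> A \<union> f ` D"
      then consider "a \<in> A" | d where "d \<in> D" "a = f d" by blast
      then show "a \<in> {u + f v |u v. u \<in> U \<and> v \<in> V}"
      proof cases
        case 1
        then have "a = a + f 0" "a \<in> U" "0 \<in> V"
          using A V subspace_0 by auto
        then show ?thesis by blast
      next
        case (2 d)
        then have "a = 0 + f d" "d \<in> V" "0 \<in> U"
          using B1 U subspace_0 by (auto simp: D_def)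
        then show ?thesis by blast
      qed
    qed
    show "{u + f v |u v. u \<in> U \<and> v \<in> V} \<subseteq> span (A \<union> f ` D)"
    proof clarify
      fix u v assume u: "u \<in> U" and v: "v \<in> V"
      have "B1 = B0 \<union> D" using B1 by (auto simp: D_def)
      then have "v \<in> span (B0 \<union> D)" using v sB1 by simp
      then obtain k d where k: "k \<in> K" and d: "d \<in> span D" and v': "v = k + d"
        by (auto simp: span_Un sB0)
      have "f k \<in> span A" using kernel[of k] k K sA by auto
      moreover have "f d \<in> span (f ` D)" using d by (simp add: f.span_image)
      ultimately have "u + (f k + f d) \<in> span (A \<union> f ` D)"
        using u sA by (intro span_add) (auto intro: subsetD[OF span_mono])
      then show "u + f v \<in> span (A \<union> f ` D)" by (simp add: v' f.add)
    qed
  qed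
  moreover have "card B1 = dim V" using B1 by (intro basis_card_eq_dim)
  moreover have "card B1 = card B0 + card D"
    using B1 finB by (simp add: D_def card_Diff_subset finite_subset card_mono)
  ultimately show ?thesis using A B0 by simp
qed

lemma (in Vector_Spaces.vector_space) subspace_eq_if_dim_eq:
  assumes U: "subspace U" "U \<subseteq> V" and fin: "finite F" "V \<subseteq> span F" and dim: "dim U = dim V"
  shows "U = V"
proof -
  obtain B where B: "B \<subseteq> U" "independent B" "U \<subseteq> span B" "card B = dim U"
    by (rule basis_exists)
  obtain B' where B': "B \<subseteq> B'" "B' \<subseteq> V" "independent B'" "V \<subseteq> span B'"
    using maximal_independent_subset_extend[of B V] B U by blast
  have "finite B'"
    using independent_span_bound[OF fin(1) B'(3)] B'(2) fin(2) by blast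
  moreover have "card B' = card B" using B B' dim basis_card_eq_dim[of B' V] by simp
  ultimately have "B' = B" using B'(1) by (metis card_subset_eq)
  then show ?thesis using B B' U span_minimal[of B U] by blast
qed

section \<open>Homogeneous components for the total degree\<close>

definition mdeg :: "('v :: finite \<Rightarrow>\<^sub>0 nat) \<Rightarrow> int" where
  "mdeg m = int (\<Sum>v\<in>UNIV. Poly_Mapping.lookup m v)"

lemma mdeg_add: "mdeg (m + m') = mdeg m + mdeg m'"
  by (simp add: mdeg_def lookup_add sum.distrib)

lemma homog_part_iff:
  "g \<in> homog_part p \<longleftrightarrow> (\<forall>m. Poly_Mapping.lookup g m \<noteq> 0 \<longrightarrow> mdeg m = p)"
  by (simp add: homog_part_def mdeg_def Ball_def in_keys_iff)

lemma homog_part_0 [simp]: "0 \<in> homog_part p"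
  by (simp add: homog_part_iff)

lemma homog_part_add:
  "g \<in> homog_part p \<Longrightarrow> h \<in> homog_part p \<Longrightarrow> g + h \<in> homog_part p"
  for g h :: "('v :: finite, 'k :: comm_ring_1) mpoly"
  by (auto simp: homog_part_iff lookup_add) (metis add.right_neutral)

lemma homog_part_uminus: "g \<in> homog_part p \<Longrightarrow> - g \<in> homog_part p"
  for g :: "('v :: finite, 'k :: comm_ring_1) mpoly"
  by (auto simp: homog_part_iff)

lemma homog_part_diff:
  "g \<in> homog_part p \<Longrightarrow> h \<in> homog_part p \<Longrightarrow> g - h \<in> homog_part p"
  for g h :: "('v :: finite, 'k :: comm_ring_1) mpoly"
  using homog_part_add[of g p "- h"] homog_part_uminus[of h p] by simp

lemma homog_part_single: "Poly_Mapping.single m c \<in> homog_part (mdeg m)"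
  by (simp add: homog_part_iff lookup_single when_def)

lemma homog_part_mult:
  fixes g h :: "('v :: finite, 'k :: comm_ring_1) mpoly"
  assumes g: "g \<in> homog_part p" and h: "h \<in> homog_part r"
  shows "g * h \<in> homog_part (p + r)"
  unfolding homog_part_def mdeg_def[symmetric]
proof safe
  fix m assume "m \<in> Poly_Mapping.keys (g * h)"
  then obtain a b where "m = a + b" "a \<in> Poly_Mapping.keys g" "b \<in> Poly_Mapping.keys h"
    using keys_mult[of g h] by blast
  then show "mdeg m = p + r"
    using g h by (simp add: mdeg_add homog_part_iff in_keys_iff)
qed

lift_definition hcomp :: "int \<Rightarrow> ('v :: finite, 'k :: comm_ring_1) mpoly \<Rightarrow> ('v, 'k) mpoly"
  is "\<lambda>p g m. if mdeg m = p then g m else 0"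
  by (rule finite_subset) auto

lemma lookup_hcomp:
  "Poly_Mapping.lookup (hcomp p g) m = (if mdeg m = p then Poly_Mapping.lookup g m else 0)"
  by transfer simp

lemma hcomp_add: "hcomp p (g + h) = hcomp p g + hcomp p h"
  by (rule poly_mapping_eqI) (simp add: lookup_hcomp lookup_add)

lemma hcomp_diff: "hcomp p (g - h) = hcomp p g - hcomp p h"
  by (rule poly_mapping_eqI) (simp add: lookup_hcomp lookup_minus)

lemma hcomp_0 [simp]: "hcomp p 0 = 0"
  by (rule poly_mapping_eqI) (simp add: lookup_hcomp)

lemma hcomp_in [simp]: "hcomp p g \<in> homog_part p"
  by (auto simp: homog_part_iff lookup_hcomp split: if_splits)

lemma hcomp_homog: "g \<in> homog_part r \<Longrightarrow> hcomp p g = (if p = r then g else 0)"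
  by (rule poly_mapping_eqI) (auto simp: lookup_hcomp homog_part_iff)

text \<open>This makes cofactors homogeneous: in a relation between forms, a cofactor of
  \<open>g\<close> may be replaced by its component in the complementary degree.\<close>

lemma hcomp_mult:
  assumes g: "g \<in> homog_part e"
  shows "hcomp p (a * g) = hcomp (p - e) a * g"
proof (induction a rule: poly_mapping_induct_single)
  case (single m c)
  have "Poly_Mapping.single m c * g \<in> homog_part (mdeg m + e)"
    by (intro homog_part_mult homog_part_single g)
  then show ?case
    using homog_part_single[of m c] by (auto simp: hcomp_homog)
qed (auto simp: distrib_right hcomp_add)

lemma hcomp_span:
  assumes G: "\<And>g. g \<in> G \<Longrightarrow> \<exists>e. g \<in> homog_part e" and u: "u \<in> idl.span G"
  shows "hcomp p u \<in> idl.span G"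
proof (rule additive_span_in[OF _ _ _ u, where P = "hcomp p"])
  fix a g assume g: "g \<in> G"
  then obtain e where "g \<in> homog_part e" using G by blast
  then show "hcomp p (a * g) \<in> idl.span G"
    using g by (auto simp: hcomp_mult intro: idl.span_scale idl.span_base)
qed (auto simp: hcomp_add)

section \<open>Hilbert series of complete intersections\<close>

text \<open>The polynomial ring over its field of constants. Scalars are constant polynomials, so
  every ideal is automatically a subspace.\<close>

interpretation kv: Vector_Spaces.vector_space
  "\<lambda>(c :: 'k :: field) (p :: ('v :: finite, 'k) mpoly). Poly_Mapping.single 0 c * p"
  by unfold_locales
     (simp_all add: distrib_left distrib_right single_add mult.assoc[symmetric] mult_single)

declare kv.scale_scale [simp del]

lemma kv_subspace_homog_part: "kv.subspace (homog_part p)"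
  using homog_part_mult[OF homog_part_single[of 0]]
  by (intro kv.subspaceI) (auto intro: homog_part_add simp: mdeg_def)

lemma kv_subspace_idl: "idl.subspace I \<Longrightarrow> kv.subspace I"
  by (auto simp: idl.subspace_def kv.subspace_def)

section \<open>Counting monomials\<close>

definition monoms_in :: "'v :: finite set \<Rightarrow> nat \<Rightarrow> ('v \<Rightarrow>\<^sub>0 nat) set" where
  "monoms_in V p = {m. Poly_Mapping.keys m \<subseteq> V \<and> mdeg m = int p}"

lemma mdeg_single: "mdeg (Poly_Mapping.single v k) = int k"
  by (simp add: mdeg_def lookup_single when_def)

lemma mdeg_eq_0_iff: "mdeg m = 0 \<longleftrightarrow> m = 0"
proof
  assume "mdeg m = 0"
  then have "(\<Sum>v\<in>UNIV. Poly_Mapping.lookup m v) = 0" unfolding mdeg_def by linarith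
  then show "m = 0" by (intro poly_mapping_eqI) simp
qed (simp add: mdeg_def)

lemma mdeg_nonneg: "0 \<le> mdeg m"
  by (simp add: mdeg_def sum_nonneg)

lemma monoms_in_0: "monoms_in V 0 = {0}"
  by (auto simp: monoms_in_def mdeg_eq_0_iff)

lemma split_var:
  assumes "Poly_Mapping.lookup m v \<noteq> (0 :: nat)"
  shows "Poly_Mapping.single v 1 + (m - Poly_Mapping.single v 1) = m"
  using assms by (intro poly_mapping_eqI) (auto simp: lookup_add lookup_minus lookup_single when_def)

text \<open>Monomials either contain \<open>v\<close>, and can be divided by it, or are free of it.
  This recursion serves both finiteness and the generating function.\<close>

lemma monoms_in_Suc:
  "monoms_in (insert v V) (Suc p)
    = (+) (Poly_Mapping.single v 1) ` monoms_in (insert v V) p \<union> monoms_in (V - {v}) (Suc p)"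
proof safe
  fix m assume m: "m \<in> monoms_in (insert v V) (Suc p)" "m \<notin> monoms_in (V - {v}) (Suc p)"
  then have "Poly_Mapping.lookup m v \<noteq> 0"
    by (auto simp: monoms_in_def in_keys_iff)
  note eq = split_var[OF this]
  have "mdeg (m - Poly_Mapping.single v 1) = int p"
    using arg_cong[OF eq, of mdeg] m by (simp add: mdeg_add mdeg_single monoms_in_def)
  moreover have "Poly_Mapping.keys (m - Poly_Mapping.single v 1) \<subseteq> Poly_Mapping.keys m"
    by (auto simp: in_keys_iff lookup_minus)
  ultimately have "m - Poly_Mapping.single v 1 \<in> monoms_in (insert v V) p"
    using m by (auto simp: monoms_in_def)
  then show "m \<in> (+) (Poly_Mapping.single v 1) ` monoms_in (insert v V) p"
    using eq by force
next
  fix m assume "m \<in> monoms_in (insert v V) p"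
  then show "Poly_Mapping.single v 1 + m \<in> monoms_in (insert v V) (Suc p)"
    using keys_add[of "Poly_Mapping.single v 1" m]
    by (auto simp: monoms_in_def mdeg_add mdeg_single)
qed (auto simp: monoms_in_def)

lemma finite_monoms_in: "finite (monoms_in V p)"
proof (induction "card V" arbitrary: V p)
  case 0
  then have "V = {}" by simp
  then show ?case
    by (auto simp: monoms_in_def mdeg_def intro: finite_subset[of _ "{0}"])
next
  case (Suc n)
  then obtain v where v: "v \<in> V" by fastforce
  then have V: "insert v V = V" by blast
  have "finite (monoms_in (V - {v}) r)" for r
    using Suc v by (intro Suc.hyps) auto
  then show ?case
    by (induction p) (auto simp: monoms_in_0 monoms_in_Suc[of v V, unfolded V])
qed

text \<open>Multiplication by \<open>1 - X\<close> subtracts the multiples of a chosen variable and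
  leaves the count for the remaining variables.\<close>

lemma fps_monoms_in:
  "(1 - fps_X) ^ card V * Abs_fps (\<lambda>p. of_nat (card (monoms_in V p))) = (1 :: int fps)"
proof (induction "card V" arbitrary: V)
  case 0
  then have "V = {}" by simp
  then have "monoms_in V p = (if p = 0 then {0} else {})" for p
    by (auto simp: monoms_in_def mdeg_def)
  then show ?case using \<open>V = {}\<close> by (auto simp: fps_eq_iff)
next
  case (Suc n)
  then obtain v where v: "v \<in> V" by fastforce
  then have V: "insert v V = V" by blast
  let ?F = "\<lambda>V. Abs_fps (\<lambda>p. of_nat (card (monoms_in V p))) :: int fps"
  have card: "card (monoms_in V (Suc p)) = card (monoms_in V p) + card (monoms_in (V - {v}) (Suc p))" for p
  proof -
    have "v \<in> Poly_Mapping.keys (Poly_Mapping.single v 1 + m)" for m :: "'a \<Rightarrow>\<^sub>0 nat"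
      by (simp add: in_keys_iff lookup_add)
    then have "(+) (Poly_Mapping.single v 1) ` monoms_in V p \<inter> monoms_in (V - {v}) (Suc p) = {}"
      unfolding monoms_in_def by blast
    then show ?thesis
      using monoms_in_Suc[of v V p, unfolded V]
      by (simp add: card_Un_disjoint finite_monoms_in card_image)
  qed
  have "((1 - fps_X) * ?F V) $ p = ?F (V - {v}) $ p" for p
    by (cases p) (simp_all add: left_diff_distrib monoms_in_0 card)
  then have "(1 - fps_X) * ?F V = ?F (V - {v})" by (simp add: fps_eq_iff)
  moreover have "(1 - fps_X) ^ card (V - {v}) * ?F (V - {v}) = 1"
    using Suc v by (intro Suc.hyps) auto
  moreover have "card V = Suc (card (V - {v}))" using Suc v by simp
  ultimately show ?case by (simp only: power_Suc2 mult.assoc)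
qed

lemma homog_part_subset_span:
  "homog_part (int p) \<subseteq> kv.span ((\<lambda>m. Poly_Mapping.single m 1) ` monoms_in UNIV p)"
proof
  fix g :: "('v :: finite, 'k :: field) mpoly" assume g: "g \<in> homog_part (int p)"
  let ?M = "(\<lambda>m. Poly_Mapping.single m 1) ` monoms_in UNIV p :: ('v, 'k) mpoly set"
  have "Poly_Mapping.single m c \<in> kv.span ?M" if "mdeg m = int p" for m and c :: 'k
  proof -
    have "Poly_Mapping.single 0 c * Poly_Mapping.single m 1 \<in> kv.span ?M"
      using that by (intro kv.span_scale kv.span_base) (auto simp: monoms_in_def)
    then show ?thesis by (simp add: mult_single)
  qed
  then have "(\<Sum>m\<in>Poly_Mapping.keys g. Poly_Mapping.single m (Poly_Mapping.lookup g m)) \<in> kv.span ?M"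
    using g by (intro kv.span_sum) (auto simp: homog_part_iff in_keys_iff)
  then show "g \<in> kv.span ((\<lambda>m. Poly_Mapping.single m 1) ` monoms_in UNIV p)"
    by (simp only: sum_single_keys)
qed

lemma homog_part_neg: "p < 0 \<Longrightarrow> homog_part p = {0}"
  by (auto simp: homog_part_iff poly_mapping_eq_iff fun_eq_iff) (metis mdeg_nonneg not_less)

lemma homog_part_finite_span: "\<exists>F. finite F \<and> homog_part p \<subseteq> kv.span F"
proof (cases "p < 0")
  case True
  then show ?thesis by (auto simp: homog_part_neg)
next
  case False
  then show ?thesis
    using homog_part_subset_span[of "nat p"] finite_monoms_in[of UNIV "nat p"] by auto
qed

lemma dim_homog_part:
  "kv.dim (homog_part (int p) :: ('v :: finite, 'k :: field) mpoly set) = card (monoms_in (UNIV :: 'v set) p)"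
proof (rule kv.dim_unique)
  let ?x = "\<lambda>m. Poly_Mapping.single m 1 :: ('v, 'k) mpoly"
  let ?M = "monoms_in (UNIV :: 'v set) p"
  show "?x ` ?M \<subseteq> homog_part (int p)"
    by (auto simp: monoms_in_def homog_part_iff lookup_single when_def)
  show "homog_part (int p) \<subseteq> kv.span (?x ` ?M)" by (rule homog_part_subset_span)
  have inj: "inj_on ?x ?M"
    by (auto intro!: inj_onI dest: arg_cong[where f = Poly_Mapping.keys])
  then show "card (?x ` ?M) = card ?M" by (rule card_image)
  show "kv.independent (?x ` ?M)"
  proof (rule kv.independent_if_scalars_zero)
    show "finite (?x ` ?M)" by (simp add: finite_monoms_in)
    fix h y assume 0: "(\<Sum>y\<in>?x ` ?M. Poly_Mapping.single 0 (h y) * y) = 0" and "y \<in> ?x ` ?M"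
    then obtain m where m: "m \<in> ?M" "y = ?x m" by blast
    have "(\<Sum>m\<in>?M. Poly_Mapping.single m (h (?x m))) = 0"
      using 0 by (simp add: sum.reindex[OF inj] mult_single)
    then have "Poly_Mapping.lookup (\<Sum>m\<in>?M. Poly_Mapping.single m (h (?x m))) m = 0" by simp
    then show "h y = 0"
      using m by (simp add: lookup_sum lookup_single when_def finite_monoms_in)
  qed
qed

text \<open>For an ideal \<open>I\<close> the coefficients are the dimensions of the graded parts of
  \<open>S/I\<close>, formed as integer differences without quotient spaces.\<close>

definition hilbert_series :: "('v :: finite, 'k :: field) mpoly set \<Rightarrow> int fps" where
  "hilbert_series I =
     Abs_fps (\<lambda>p. int (kv.dim (homog_part (int p) :: ('v, 'k) mpoly set)) - int (kv.dim (I \<inter> homog_part (int p))))"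

text \<open>The degree \<open>p\<close> part of the larger ideal is the old part plus
  \<open>g\<close> times the forms of degree \<open>p - e\<close>. Regularity says that the kernel
  of multiplication by \<open>g\<close> modulo the old ideal is the old ideal, so the rank formula
  applies.\<close>

lemma dim_graded_insert:
  fixes g :: "('v :: finite, 'k :: field) mpoly"
  assumes G: "\<And>h. h \<in> G \<Longrightarrow> \<exists>e. h \<in> homog_part e"
    and g: "g \<in> homog_part e" and reg: "regular_mod (idl.span G) g"
  shows "kv.dim (idl.span (insert g G) \<inter> homog_part p) + kv.dim (idl.span G \<inter> homog_part (p - e))
       = kv.dim (idl.span G \<inter> homog_part p) + kv.dim (homog_part (p - e) :: ('v, 'k) mpoly set)"
proof -
  let ?I = "idl.span G"
  have "idl.span (insert g G) \<inter> homog_part p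
      = {u + g * v |u v. u \<in> ?I \<inter> homog_part p \<and> v \<in> homog_part (p - e)}"
  proof safe
    fix u assume u: "u \<in> idl.span (insert g G)" and up: "u \<in> homog_part p"
    then obtain k where k: "u - k * g \<in> ?I" by (auto simp: idl.span_insert)
    have "hcomp p (u - k * g) = u - g * hcomp (p - e) k"
      by (simp add: hcomp_diff hcomp_homog[OF up] hcomp_mult[OF g])
    moreover have "hcomp p (u - k * g) \<in> ?I" by (rule hcomp_span[OF G k])
    moreover have "hcomp p (u - k * g) \<in> homog_part p" by simp
    ultimately show "\<exists>a b. u = a + g * b \<and> a \<in> ?I \<inter> homog_part p \<and> b \<in> homog_part (p - e)"
      by (intro exI[of _ "u - g * hcomp (p - e) k"] exI[of _ "hcomp (p - e) k"]) simp
  next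
    fix u v :: "('v, 'k) mpoly"
    assume u: "u \<in> ?I" "u \<in> homog_part p" and v: "v \<in> homog_part (p - e)"
    have "u + g * v - v * g = u" by simp
    then show "u + g * v \<in> idl.span (insert g G)"
      using u(1) unfolding idl.span_insert by (metis (mono_tags, lifting) mem_Collect_eq)
    show "u + g * v \<in> homog_part p"
      using homog_part_add[OF u(2), of "g * v"] homog_part_mult[OF g v] by simp
  qed
  moreover obtain F where F: "finite F" "homog_part (p - e) \<subseteq> kv.span (F :: ('v, 'k) mpoly set)"
    using homog_part_finite_span by blast
  moreover obtain F' where F': "finite F'" "homog_part p \<subseteq> kv.span (F' :: ('v, 'k) mpoly set)"
    using homog_part_finite_span by blast
  moreover have "Vector_Spaces.linear (\<lambda>c p. Poly_Mapping.single 0 c * p)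
      (\<lambda>c p. Poly_Mapping.single 0 c * p) ((*) g)"
    by unfold_locales (auto simp: distrib_left mult.left_commute)
  moreover have "g * v \<in> ?I \<inter> homog_part p \<longleftrightarrow> v \<in> ?I \<inter> homog_part (p - e)"
    if "v \<in> homog_part (p - e)" for v :: "('v, 'k) mpoly"
    using that homog_part_mult[OF g that] regular_modD[OF reg] idl.span_scale[of v G g] by auto
  ultimately show ?thesis
    using kv.dim_add_image[of "?I \<inter> homog_part p" "homog_part (p - e)" "?I \<inter> homog_part (p - e)" "(*) g" F F']
    by (simp add: le_infI2 kv.subspace_inter kv_subspace_idl kv_subspace_homog_part)
qed

lemma hilbert_series_insert:
  assumes "\<And>h. h \<in> G \<Longrightarrow> \<exists>e. h \<in> homog_part e"
    and "g \<in> homog_part (int e)" and "regular_mod (idl.span G) g"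
  shows "hilbert_series (idl.span (insert g G)) = (1 - fps_X ^ e) * hilbert_series (idl.span G)"
proof (rule fps_ext)
  fix p
  show "hilbert_series (idl.span (insert g G)) $ p = ((1 - fps_X ^ e) * hilbert_series (idl.span G)) $ p"
    using dim_graded_insert[OF assms, of "int p"]
    by (cases "p < e")
       (simp_all add: hilbert_series_def left_diff_distrib fps_X_power_mult_nth homog_part_neg
          of_nat_diff idl.span_zero algebra_simps)
qed

text \<open>The quotient of \<open>1 - X^e\<close> by \<open>1 - X\<close>, kept as a polynomial so
  that degree and leading coefficient are available.\<close>

definition geom_poly :: "nat \<Rightarrow> int poly" where
  "geom_poly e = (\<Sum>i<e. Polynomial.monom 1 i)"

lemma geom_poly_props:
  assumes "1 \<le> e"
  shows "degree (geom_poly e) = e - 1" "lead_coeff (geom_poly e) = 1" "geom_poly e \<noteq> 0"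
proof -
  have c: "coeff (geom_poly e) i = (if i < e then 1 else 0)" for i
    by (simp add: geom_poly_def coeff_sum)
  show d: "degree (geom_poly e) = e - 1"
  proof (rule antisym)
    show "degree (geom_poly e) \<le> e - 1" using assms by (intro degree_le) (auto simp: c)
    show "e - 1 \<le> degree (geom_poly e)" using assms by (intro le_degree) (simp add: c)
  qed
  show "lead_coeff (geom_poly e) = 1" using assms by (simp add: d c)
  then show "geom_poly e \<noteq> 0" by auto
qed

text \<open>With as many forms as variables, the factors \<open>1 - X\<close> cancel the series of
  the polynomial ring. The Hilbert series is then a monic polynomial of degree \<open>Q\<close>:
  nonzero in degree \<open>Q\<close>, zero above.\<close>

theorem complete_intersection_top_degree:
  fixes g :: "nat \<Rightarrow> ('v :: finite, 'k :: field) mpoly"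
  assumes N: "N = CARD('v)"
    and g: "\<And>i. i < N \<Longrightarrow> g i \<in> homog_part (int (e i))"
    and e: "\<And>i. i < N \<Longrightarrow> 1 \<le> e i"
    and reg: "\<And>i. i < N \<Longrightarrow> regular_mod (idl.span (g ` {..<i})) (g i)"
  defines "Q \<equiv> \<Sum>i<N. e i - 1"
  shows "\<not> homog_part (int Q) \<subseteq> idl.span (g ` {..<N})"
    and "Q < p \<Longrightarrow> homog_part (int p) \<subseteq> idl.span (g ` {..<N})"
proof -
  let ?W = "idl.span (g ` {..<N})"
  have H: "hilbert_series (idl.span (g ` {..<i})) = (\<Prod>j<i. 1 - fps_X ^ e j) * hilbert_series (idl.span {} :: ('v, 'k) mpoly set)"
    if "i \<le> N" for i
    using that
  proof (induction i)
    case (Suc i)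
    have "\<exists>e. h \<in> homog_part e" if "h \<in> g ` {..<i}" for h
    proof -
      from that obtain j where "j < i" "h = g j" by blast
      then have "h \<in> homog_part (int (e j))" using g[of j] Suc.prems by simp
      then show ?thesis ..
    qed
    then have "hilbert_series (idl.span (insert (g i) (g ` {..<i}))) = (1 - fps_X ^ e i) * hilbert_series (idl.span (g ` {..<i}))"
      using Suc.prems g reg by (intro hilbert_series_insert) auto
    then show ?case using Suc by (simp add: lessThan_Suc algebra_simps)
  qed simp
  have "kv.dim ({0} :: ('v, 'k) mpoly set) = 0"
    using kv.dim_le_card[of "{0}" "{}"] by simp
  moreover have "{0} \<inter> homog_part r = ({0} :: ('v, 'k) mpoly set)" for r by auto
  ultimately have H0: "hilbert_series ({0} :: ('v, 'k) mpoly set)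
      = Abs_fps (\<lambda>p. of_nat (card (monoms_in (UNIV :: 'v set) p)))"
    by (simp add: hilbert_series_def dim_homog_part)
  have geom: "1 - fps_X ^ k = (1 - fps_X) * fps_of_poly (geom_poly k)" for k
    by (simp add: geom_poly_def fps_of_poly_sum fps_of_poly_monom' one_diff_power_eq)
  have "hilbert_series ?W = fps_of_poly (\<Prod>j<N. geom_poly (e j))
      * ((1 - fps_X) ^ CARD('v) * Abs_fps (\<lambda>p. of_nat (card (monoms_in (UNIV :: 'v set) p))))"
    unfolding H[OF order_refl] geom prod.distrib
    by (simp add: H0 N fps_of_poly_prod algebra_simps)
  then have HW: "hilbert_series ?W $ p = coeff (\<Prod>j<N. geom_poly (e j)) p" for p
    by (simp add: fps_monoms_in)
  have deg: "degree (\<Prod>j<N. geom_poly (e j)) = Q"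
    using geom_poly_props e by (subst degree_prod_sum_eq) (auto simp: Q_def)
  have lead: "lead_coeff (\<Prod>j<N. geom_poly (e j)) = 1"
    using geom_poly_props e by (simp add: lead_coeff_prod)
  show "\<not> homog_part (int Q) \<subseteq> ?W"
  proof
    assume "homog_part (int Q) \<subseteq> ?W"
    then have "?W \<inter> homog_part (int Q) = homog_part (int Q)" by blast
    then have "hilbert_series ?W $ Q = 0" by (simp add: hilbert_series_def)
    then show False using lead by (simp add: HW deg)
  qed
  show "homog_part (int p) \<subseteq> ?W" if "Q < p"
  proof -
    obtain F where F: "finite F" "homog_part (int p) \<subseteq> kv.span (F :: ('v, 'k) mpoly set)"
      using homog_part_finite_span by blast
    have "hilbert_series ?W $ p = 0"
      unfolding HW using that deg by (intro coeff_eq_0) simp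
    then have "kv.dim (?W \<inter> homog_part (int p)) = kv.dim (homog_part (int p) :: ('v, 'k) mpoly set)"
      by (simp add: hilbert_series_def)
    then have "?W \<inter> homog_part (int p) = homog_part (int p)"
      by (intro kv.subspace_eq_if_dim_eq[OF _ _ F] kv.subspace_inter kv_subspace_idl kv_subspace_homog_part) auto
    then show ?thesis by blast
  qed
qed

section \<open>Duality in a graded complete intersection\<close>

text \<open>Numbering the variables embeds the ring into polynomials with variables indexed by
  naturals. Their exponents are linearly ordered compatibly with addition, so there are no zero
  divisors.\<close>

lemma mpoly_mult_eq_0:
  fixes p q :: "('v :: finite, 'k :: field) mpoly"
  assumes "p * q = 0" "p \<noteq> 0"
  shows "q = 0"
proof -
  obtain h :: "'v \<Rightarrow> nat" where h: "inj h"
    using finite_imp_inj_to_nat_seg[OF finite_class.finite_UNIV] by metis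
  define t :: "('v \<Rightarrow>\<^sub>0 nat) \<Rightarrow> (nat \<Rightarrow>\<^sub>0 nat)"
    where "t m = (\<Sum>v\<in>UNIV. Poly_Mapping.single (h v) (Poly_Mapping.lookup m v))" for m
  have t_add: "t (m + m') = t m + t m'" for m m'
    by (simp add: t_def lookup_add single_add sum.distrib)
  have "Poly_Mapping.lookup (t m) (h v) = Poly_Mapping.lookup m v" for m v
    by (simp add: t_def lookup_sum lookup_single when_def inj_eq[OF h])
  then have t_inj: "inj t" by (metis injI poly_mapping_eqI)
  define F :: "('v, 'k) mpoly \<Rightarrow> (nat \<Rightarrow>\<^sub>0 nat) \<Rightarrow>\<^sub>0 'k"
    where "F p = (\<Sum>m\<in>Poly_Mapping.keys p. Poly_Mapping.single (t m) (Poly_Mapping.lookup p m))" for p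
  have F_lookup: "Poly_Mapping.lookup (F p) k = (if k \<in> Set.range t then Poly_Mapping.lookup p (inv_into UNIV t k) else 0)" for p k
  proof (cases "k \<in> Set.range t")
    case True
    then obtain m where k: "k = t m" by blast
    then show ?thesis
      by (simp add: F_def lookup_sum lookup_single when_def inj_eq[OF t_inj] inv_f_f[OF t_inj] in_keys_iff)
  next
    case False
    then have "t m \<noteq> k" for m by auto
    with False show ?thesis by (simp add: F_def lookup_sum lookup_single)
  qed
  have F_add: "F (p + q) = F p + F q" for p q
    by (rule poly_mapping_eqI) (simp add: F_lookup lookup_add)
  have F_single: "F (Poly_Mapping.single m c) = Poly_Mapping.single (t m) c" for m c
    by (cases "c = 0") (simp_all add: F_def)
  have "F (Poly_Mapping.single m c * q) = F (Poly_Mapping.single m c) * F q" for m c q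
    by (induction q rule: poly_mapping_induct_single)
       (simp_all add: F_single F_add mult_single t_add distrib_left, simp add: F_def)
  then have F_mult: "F (p * q) = F p * F q" for p q
    by (induction p rule: poly_mapping_induct_single)
       (simp_all add: F_add distrib_right, simp add: F_def)
  have F_0: "F p = 0 \<longleftrightarrow> p = 0" for p
  proof
    assume "F p = 0"
    then have "Poly_Mapping.lookup (F p) (t m) = 0" for m by simp
    then show "p = 0" by (intro poly_mapping_eqI) (simp add: F_lookup inv_f_f[OF t_inj])
  qed (simp add: F_def)
  have "F p * F q = 0" using assms(1) by (simp add: F_0 flip: F_mult)
  then show "q = 0" using assms(2) by (simp add: F_0)
qed

text \<open>Induction on \<open>T\<close>: on the kernel of \<open>M j\<close> the other functionals
  suffice; the remaining difference \<open>h\<close> vanishes on that kernel and is therefore a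
  multiple of \<open>M j\<close>. In the duality argument the coefficients become those of a
  preimage.\<close>

lemma (in Vector_Spaces.vector_space) functional_combination:
  assumes "finite T"
    and L: "\<And>x y. L (x + y) = L x + L y" "\<And>c x. L (scale c x) = c * L x"
    and M: "\<And>i x y. M i (x + y) = M i x + M i y" "\<And>i c x. M i (scale c x) = c * M i x"
    and "subspace V"
    and "\<And>x. x \<in> V \<Longrightarrow> (\<forall>i\<in>T. M i x = 0) \<Longrightarrow> L x = 0"
  shows "\<exists>c. \<forall>x\<in>V. L x = (\<Sum>i\<in>T. c i * M i x)"
  using assms(1,6,7)
proof (induction T arbitrary: V rule: finite_induct)
  case (insert j T)
  define V' where "V' = {x \<in> V. M j x = 0}"
  have M0: "M i 0 = 0" for i using M(2)[of i 0 0] by simp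
  have "subspace V'"
    using insert.prems(1) by (auto simp: V'_def subspace_def M M0)
  moreover have "L x = 0" if "x \<in> V'" "\<forall>i\<in>T. M i x = 0" for x
    using insert.prems(2) that by (auto simp: V'_def)
  ultimately obtain c where c: "\<And>x. x \<in> V' \<Longrightarrow> L x = (\<Sum>i\<in>T. c i * M i x)"
    using insert.IH by metis
  define h where "h x = L x - (\<Sum>i\<in>T. c i * M i x)" for x
  have "\<exists>b. \<forall>x\<in>V. h x = b * M j x"
  proof (cases "\<forall>x\<in>V. M j x = 0")
    case True
    then show ?thesis using c by (auto simp: h_def V'_def)
  next
    case False
    then obtain y where y: "y \<in> V" "M j y \<noteq> 0" by blast
    have h_add: "h (x + x') = h x + h x'" for x x'
      by (simp add: h_def L M distrib_left sum.distrib)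
    have h_scale: "h (scale a x) = a * h x" for a x
      by (simp add: h_def L M right_diff_distrib sum_distrib_left mult.left_commute)
    have "h x = (h y / M j y) * M j x" if "x \<in> V" for x
    proof -
      \<comment> \<open>Chosen so that \<open>x + a y\<close> lies in the kernel of
        \<open>M j\<close>.\<close>
      define a where "a = - (M j x / M j y)"
      have "M j (x + scale a y) = 0" using y by (simp only: M) (simp add: a_def)
      then have "x + scale a y \<in> V'"
        using that y insert.prems(1) by (simp add: V'_def subspace_add subspace_scale)
      then have "h (x + scale a y) = 0" using c by (simp add: h_def)
      then have "h x + a * h y = 0" by (simp only: h_add h_scale)
      then show ?thesis using y by (simp add: a_def field_simps)
    qed
    then show ?thesis by blast
  qed
  then obtain b where b: "\<And>x. x \<in> V \<Longrightarrow> h x = b * M j x" by blast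
  have "L x = (\<Sum>i\<in>insert j T. (c(j := b)) i * M i x)" if "x \<in> V" for x
  proof -
    have "(\<Sum>i\<in>T. (c(j := b)) i * M i x) = (\<Sum>i\<in>T. c i * M i x)"
      using insert.hyps(2) by (intro sum.cong) auto
    then show ?thesis using b[OF that] insert.hyps by (simp add: h_def diff_eq_eq)
  qed
  then show ?case by blast
qed auto

abbreviation pvar :: "'v \<Rightarrow> ('v :: finite, 'k :: comm_ring_1) mpoly" where
  "pvar v \<equiv> Poly_Mapping.single (Poly_Mapping.single v 1) 1"

lemma pvar_homog: "pvar v \<in> homog_part 1"
  using homog_part_single[of "Poly_Mapping.single v 1" 1] by (simp add: mdeg_single)

lemma in_span_pvar:
  assumes "Poly_Mapping.lookup a 0 = 0"
  shows "a \<in> idl.span (Set.range pvar)"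
proof -
  have "Poly_Mapping.single m (Poly_Mapping.lookup a m) \<in> idl.span (Set.range pvar)"
    if "m \<in> Poly_Mapping.keys a" for m
  proof -
    have "m \<noteq> 0" using that assms by (auto simp: in_keys_iff)
    then obtain v where "Poly_Mapping.lookup m v \<noteq> 0"
      by (metis lookup_zero poly_mapping_eqI)
    note eq = split_var[OF this]
    have "Poly_Mapping.single (m - Poly_Mapping.single v 1) (Poly_Mapping.lookup a m) * pvar v
        \<in> idl.span (Set.range pvar)"
      by (intro idl.span_scale idl.span_base) auto
    then show ?thesis using eq by (simp add: mult_single add.commute)
  qed
  then have "(\<Sum>m\<in>Poly_Mapping.keys a. Poly_Mapping.single m (Poly_Mapping.lookup a m))
      \<in> idl.span (Set.range pvar)"
    by (intro idl.span_sum)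
  then show ?thesis by (simp only: sum_single_keys)
qed

locale homogeneous_complete_intersection =
  fixes g :: "nat \<Rightarrow> ('v :: finite, 'k :: field) mpoly" and e :: "nat \<Rightarrow> nat"
  assumes g_homog: "i < CARD('v) \<Longrightarrow> g i \<in> homog_part (int (e i))"
    and e_pos: "i < CARD('v) \<Longrightarrow> 1 \<le> e i"
    and g_regular: "i < CARD('v) \<Longrightarrow> regular_mod (idl.span (g ` {..<i})) (g i)"
begin

definition W :: "('v, 'k) mpoly set" where
  "W = idl.span (g ` {..<CARD('v)})"

definition Q :: int where
  "Q = int (\<Sum>i<CARD('v). e i - 1)"

lemma subspace_W: "idl.subspace W"
  by (simp add: W_def)

lemmas W_add = idl.subspace_add[OF subspace_W]
lemmas W_diff = idl.subspace_diff[OF subspace_W]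
lemmas W_scale = idl.subspace_scale[OF subspace_W]
lemmas W_0 = idl.subspace_0[OF subspace_W]

lemma hcomp_W: "u \<in> W \<Longrightarrow> hcomp p u \<in> W"
  unfolding W_def by (rule hcomp_span) (use g_homog in auto)

lemma top_not_in_W: "\<exists>s \<in> homog_part Q. s \<notin> W"
  using complete_intersection_top_degree(1)[OF refl g_homog e_pos g_regular]
  by (auto simp: Q_def W_def simp del: of_nat_sum)

lemma above_top_in_W:
  assumes "Q < p" "u \<in> homog_part p" shows "u \<in> W"
proof -
  have "0 \<le> Q" unfolding Q_def by (rule of_nat_0_le_iff)
  then have "int (nat p) = p" using assms(1) by simp
  moreover from this have "(\<Sum>i<CARD('v). e i - 1) < nat p"
    using assms(1) unfolding Q_def by linarith
  ultimately show ?thesis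
    using complete_intersection_top_degree(2)[OF refl g_homog e_pos g_regular, of "nat p"] assms(2)
    by (auto simp: W_def)
qed

text \<open>The element \<open>s\<close> is a socle element because nothing survives above degree
  \<open>Q\<close>. Rank one then gives a relation with polynomial coefficients, of which only the
  constant terms act on socle elements.\<close>

lemma socle_in_multiple_of_top:
  assumes s: "s \<in> homog_part Q" "s \<notin> W"
    and z: "\<And>v. pvar v * z \<in> W"
  shows "\<exists>b c. c \<noteq> 0 \<and> Poly_Mapping.single 0 b * s - Poly_Mapping.single 0 c * z \<in> W"
proof -
  obtain h where h: "bij_betw h {0..<CARD('v)} (UNIV :: 'v set)"
    using ex_bij_betw_nat_finite[OF finite_class.finite_UNIV] by metis
  define x :: "nat \<Rightarrow> ('v, 'k) mpoly" where "x = (\<lambda>i. pvar (h i))"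
  have x: "x ` {..<CARD('v)} = Set.range pvar"
  proof -
    have "h ` {..<CARD('v)} = UNIV" using h by (simp add: bij_betw_def atLeast0LessThan)
    then show ?thesis using image_image[of pvar h "{..<CARD('v)}", symmetric] by (simp only: x_def)
  qed
  have "\<exists>a b. a \<notin> idl.span (x ` {..<CARD('v)}) \<and> b * s - a * z \<in> idl.span (g ` {..<CARD('v)})"
  proof (rule socle_rank_one)
    fix i assume i: "i < CARD('v)"
    show "g i \<in> idl.span (x ` {..<CARD('v)})"
      unfolding x using g_homog[OF i] e_pos[OF i]
      by (intro in_span_pvar) (auto simp: homog_part_iff mdeg_def)
    show "regular_mod (idl.span (g ` {..<i})) (g i)" by (rule g_regular[OF i])
    have "x i * s \<in> homog_part (1 + Q)"
      unfolding x_def by (intro homog_part_mult pvar_homog s)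
    then have "x i * s \<in> W" by (rule above_top_in_W[rotated]) simp
    then show "x i * s \<in> idl.span (g ` {..<CARD('v)})" by (simp add: W_def)
    show "x i * z \<in> idl.span (g ` {..<CARD('v)})" using z by (simp add: W_def x_def)
  next
    show "s \<notin> idl.span (g ` {..<CARD('v)})" using s by (simp add: W_def)
  qed
  then obtain a b where a: "a \<notin> idl.span (Set.range pvar)" and ab: "b * s - a * z \<in> W"
    unfolding x W_def by blast
  \<comment> \<open>A polynomial without constant term is a combination of variables, each of which
    kills \<open>u\<close>.\<close>
  have kill: "(a - Poly_Mapping.single 0 (Poly_Mapping.lookup a 0)) * u \<in> W"
    if "\<And>v. pvar v * u \<in> W" for a u
  proof -
    have "a - Poly_Mapping.single 0 (Poly_Mapping.lookup a 0) \<in> idl.span (Set.range pvar)"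
      by (rule in_span_pvar) (simp add: lookup_minus)
    moreover have "idl.span (Set.range pvar) \<subseteq> {y. y * u \<in> W}"
      using that by (intro idl.span_minimal idl_subspace_mult_left subspace_W) auto
    ultimately show ?thesis by blast
  qed
  have ps: "pvar v * s \<in> W" for v
    using above_top_in_W[of "1 + Q"] homog_part_mult[OF pvar_homog s(1)] by simp
  have "b * s - a * z - (b - Poly_Mapping.single 0 (Poly_Mapping.lookup b 0)) * s
      + (a - Poly_Mapping.single 0 (Poly_Mapping.lookup a 0)) * z \<in> W"
    by (intro W_add W_diff ab kill ps z)
  then have "Poly_Mapping.single 0 (Poly_Mapping.lookup b 0) * s
      - Poly_Mapping.single 0 (Poly_Mapping.lookup a 0) * z \<in> W"
    by (simp add: algebra_simps)
  moreover have "Poly_Mapping.lookup a 0 \<noteq> 0" using a in_span_pvar by blast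
  ultimately show ?thesis by blast
qed

lemma single_cancel_W:
  assumes "Poly_Mapping.single 0 c * z \<in> W" "c \<noteq> 0" shows "z \<in> W"
  using W_scale[OF assms(1), of "Poly_Mapping.single 0 (inverse c)"] assms(2)
  by (simp add: mult.assoc[symmetric] mult_single)

text \<open>In the relation between \<open>s\<close> and \<open>z\<close> the component of degree
  \<open>r\<close> contains only the multiple of \<open>z\<close>.\<close>

lemma socle_in_top_degree:
  assumes z: "z \<in> homog_part r" "\<And>v. pvar v * z \<in> W" and r: "r \<noteq> Q"
  shows "z \<in> W"
proof -
  obtain s where s: "s \<in> homog_part Q" "s \<notin> W" using top_not_in_W by blast
  obtain b c where c: "c \<noteq> 0" and bc: "Poly_Mapping.single 0 b * s - Poly_Mapping.single 0 c * z \<in> W"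
    using socle_in_multiple_of_top[OF s z(2)] by blast
  have "Poly_Mapping.single 0 b * s \<in> homog_part Q" "Poly_Mapping.single 0 c * z \<in> homog_part r"
    using homog_part_mult[OF homog_part_single[of 0 b] s(1)] homog_part_mult[OF homog_part_single[of 0 c] z(1)]
    by (simp_all add: mdeg_def)
  then have "hcomp r (Poly_Mapping.single 0 b * s - Poly_Mapping.single 0 c * z) = - (Poly_Mapping.single 0 c * z)"
    using r by (simp add: hcomp_diff hcomp_homog)
  then have "- (Poly_Mapping.single 0 c * z) \<in> W"
    using hcomp_W[OF bc, of r] by simp
  then have "Poly_Mapping.single 0 c * z \<in> W"
    using idl.subspace_neg[OF subspace_W] by fastforce
  then show ?thesis using c by (rule single_cancel_W)
qed

lemma top_one_dimensional:
  assumes s: "s \<in> homog_part Q" "s \<notin> W" and z: "z \<in> homog_part Q"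
  shows "\<exists>c. z - Poly_Mapping.single 0 c * s \<in> W"
proof -
  have "pvar v * z \<in> W" for v
    using above_top_in_W[of "1 + Q"] homog_part_mult[OF pvar_homog z] by simp
  from socle_in_multiple_of_top[OF s this] obtain b c
    where c: "c \<noteq> 0" and bc: "Poly_Mapping.single 0 b * s - Poly_Mapping.single 0 c * z \<in> W" by blast
  have "Poly_Mapping.single 0 (- inverse c) * (Poly_Mapping.single 0 b * s - Poly_Mapping.single 0 c * z) \<in> W"
    by (rule W_scale[OF bc])
  moreover have "Poly_Mapping.single 0 (- inverse c) * (Poly_Mapping.single 0 b * s - Poly_Mapping.single 0 c * z)
      = z - Poly_Mapping.single 0 (inverse c * b) * s"
    using c by (simp add: right_diff_distrib mult.assoc[symmetric] mult_single)
  ultimately show ?thesis by auto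
qed

text \<open>Below degree \<open>Q\<close> a nonzero class is not in the socle, so some variable
  keeps it nonzero; this climbs one degree at a time.\<close>

lemma nonzero_multiple:
  assumes "u \<in> homog_part r" "u \<notin> W" "r \<le> t" "t \<le> Q"
  shows "\<exists>v \<in> homog_part (t - r). u * v \<notin> W"
  using assms
proof (induction "nat (t - r)" arbitrary: u r)
  case 0
  then have "t - r = 0" by simp
  then show ?case
    using 0 homog_part_single[of "0 :: 'v \<Rightarrow>\<^sub>0 nat" "1 :: 'k"]
    by (intro bexI[of _ 1]) (auto simp: mdeg_def)
next
  case (Suc i)
  then have "r \<noteq> Q" by linarith
  then obtain v where v: "pvar v * u \<notin> W" using socle_in_top_degree[OF Suc.prems(1)] Suc.prems by blast
  have "pvar v * u \<in> homog_part (1 + r)" by (intro homog_part_mult pvar_homog Suc.prems)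
  then have "\<exists>w \<in> homog_part (t - (1 + r)). pvar v * u * w \<notin> W"
    using Suc v by (intro Suc.hyps) auto
  then obtain w where w: "w \<in> homog_part (t - (1 + r))" "pvar v * u * w \<notin> W" by blast
  then show ?case
    using homog_part_mult[OF pvar_homog[of v] w(1)]
    by (intro bexI[of _ "pvar v * w"]) (simp_all add: algebra_simps)
qed

lemma degree_le_top: "u \<in> homog_part r \<Longrightarrow> u \<notin> W \<Longrightarrow> r \<le> Q"
  using above_top_in_W by (meson not_less)

text \<open>A nonzero kernel class in degree \<open>r\<close> would have a nonzero multiple in
  degree \<open>k\<close>, again in the kernel.\<close>

lemma mult_injective_below:
  assumes inj: "\<And>w. w \<in> homog_part k \<Longrightarrow> a * w \<in> W \<Longrightarrow> w \<in> W"
    and k: "k \<le> Q" and r: "r \<le> k" and u: "u \<in> homog_part r" "a * u \<in> W"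
  shows "u \<in> W"
proof (rule ccontr)
  assume "u \<notin> W"
  then obtain v where v: "v \<in> homog_part (k - r)" "u * v \<notin> W"
    using nonzero_multiple[OF u(1) _ r k] by blast
  have "a * (u * v) \<in> W" using W_scale[OF u(2), of v] by (simp add: algebra_simps)
  moreover have "u * v \<in> homog_part k" using homog_part_mult[OF u(1) v(1)] by simp
  ultimately show False using inj v by blast
qed

section \<open>The pairing into the top degree and the dual of injectivity\<close>

lemma top_functional:
  obtains \<phi> :: "('v, 'k) mpoly \<Rightarrow> 'k"
  where "\<And>x y. \<phi> (x + y) = \<phi> x + \<phi> y" "\<And>c x. \<phi> (Poly_Mapping.single 0 c * x) = c * \<phi> x"
    "\<And>x. x \<in> homog_part Q \<Longrightarrow> \<phi> x = 0 \<longleftrightarrow> x \<in> W"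
proof -
  obtain s where s: "s \<in> homog_part Q" "s \<notin> W" using top_not_in_W by blast
  \<comment> \<open>The coordinate of the top component relative to \<open>s\<close>. It exists
    because the top degree is a line and is unique because \<open>s\<close> is nonzero there;
    passing through \<open>hcomp\<close> makes it linear on the whole ring.\<close>
  define \<phi> where "\<phi> x = (SOME c. hcomp Q x - Poly_Mapping.single 0 c * s \<in> W)" for x
  have \<phi>: "hcomp Q x - Poly_Mapping.single 0 (\<phi> x) * s \<in> W" for x
    unfolding \<phi>_def by (rule someI_ex, rule top_one_dimensional[OF s]) simp
  have unique: "\<phi> x = c" if c: "hcomp Q x - Poly_Mapping.single 0 c * s \<in> W" for x c
  proof (rule ccontr)
    assume "\<phi> x \<noteq> c"
    have "Poly_Mapping.single 0 (\<phi> x - c) * s \<in> W"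
      using W_diff[OF c \<phi>[of x]] by (simp add: left_diff_distrib single_diff)
    then show False using \<open>\<phi> x \<noteq> c\<close> s(2) single_cancel_W by auto
  qed
  show thesis
  proof
    fix x y
    show "\<phi> (x + y) = \<phi> x + \<phi> y"
      using W_add[OF \<phi>[of x] \<phi>[of y]]
      by (intro unique) (simp add: hcomp_add single_add algebra_simps)
    fix c
    have "hcomp Q (Poly_Mapping.single 0 c * x) = Poly_Mapping.single 0 c * hcomp Q x"
      using hcomp_mult[OF homog_part_single[of 0 c], of Q x] by (simp add: mdeg_def mult.commute)
    then show "\<phi> (Poly_Mapping.single 0 c * x) = c * \<phi> x"
      using W_scale[OF \<phi>[of x], of "Poly_Mapping.single 0 c"]
      by (intro unique) (simp add: right_diff_distrib mult.assoc[symmetric] mult_single)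
  next
    fix x :: "('v, 'k) mpoly" assume "x \<in> homog_part Q"
    then have "hcomp Q x = x" by (simp add: hcomp_homog)
    then show "\<phi> x = 0 \<longleftrightarrow> x \<in> W"
      using \<phi>[of x] unique[of x 0] by auto
  qed
qed

text \<open>Multiplication by \<open>a\<close> from degree \<open>Q - k - d\<close> to
  \<open>Q - k\<close> is dual, under the top pairing, to multiplication from degree
  \<open>k\<close> to \<open>k + d\<close>. Concretely, pairing with \<open>y\<close> is a
  combination of the pairings with \<open>a\<close> times monomials, and the coefficients form the
  preimage.\<close>

lemma mult_surjective_dual:
  assumes a: "a \<in> homog_part d"
    and inj: "\<And>w. w \<in> homog_part k \<Longrightarrow> a * w \<in> W \<Longrightarrow> w \<in> W"
    and k: "0 \<le> k" and y: "y \<in> homog_part (Q - k)"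
  shows "\<exists>m \<in> homog_part (Q - k - d). y - a * m \<in> W"
proof -
  obtain \<phi> where \<phi>_add: "\<And>x y. \<phi> (x + y) = \<phi> x + \<phi> y"
    and \<phi>_scale: "\<And>c x. \<phi> (Poly_Mapping.single 0 c * x) = c * \<phi> x"
    and \<phi>_0: "\<And>x. x \<in> homog_part Q \<Longrightarrow> \<phi> x = 0 \<longleftrightarrow> x \<in> W"
    using top_functional by blast
  have \<phi>_zero: "\<phi> 0 = 0" using \<phi>_scale[of 0 0] by simp
  have \<phi>_sum: "\<phi> (\<Sum>i\<in>T. h i) = (\<Sum>i\<in>T. \<phi> (h i))" for h and T :: "('v \<Rightarrow>\<^sub>0 nat) set"
    by (induction T rule: infinite_finite_induct) (simp_all add: \<phi>_add \<phi>_zero)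
  \<comment> \<open>Empty if \<open>Q - k - d\<close> is negative; the preimage is then 0.\<close>
  define T :: "('v \<Rightarrow>\<^sub>0 nat) set" where "T = {m. mdeg m = Q - k - d}"
  have "T \<subseteq> monoms_in UNIV (nat (Q - k - d))"
  proof
    fix m assume "m \<in> T"
    then show "m \<in> monoms_in UNIV (nat (Q - k - d))"
      using mdeg_nonneg[of m] by (simp add: T_def monoms_in_def)
  qed
  then have finT: "finite T" using finite_monoms_in finite_subset by blast
  have T_iff: "m \<in> T \<longleftrightarrow> mdeg m = Q - k - d" for m by (simp add: T_def)
  have expand: "\<phi> (x * (\<Sum>m\<in>T. Poly_Mapping.single m (c m))) = (\<Sum>m\<in>T. c m * \<phi> (x * Poly_Mapping.single m 1))"
    for x c
  proof -
    have "x * Poly_Mapping.single m (c m) = Poly_Mapping.single 0 (c m) * (x * Poly_Mapping.single m 1)" for m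
      by (simp add: mult.left_commute[of _ x] mult_single)
    then show ?thesis by (simp add: sum_distrib_left \<phi>_sum \<phi>_scale)
  qed
  have T_homog: "(\<Sum>m\<in>T. Poly_Mapping.single m (c m)) \<in> homog_part (Q - k - d)" for c :: "_ \<Rightarrow> 'k"
    by (auto simp: homog_part_iff lookup_sum lookup_single when_def finT T_iff split: if_splits)
  have T_sum: "v = (\<Sum>m\<in>T. Poly_Mapping.single m (Poly_Mapping.lookup v m))"
    if "v \<in> homog_part (Q - k - d)" for v :: "('v, 'k) mpoly"
    using that by (intro poly_mapping_eqI)
      (auto simp: homog_part_iff lookup_sum lookup_single when_def finT T_iff)
  have "\<exists>c. \<forall>x\<in>homog_part k. \<phi> (x * y) = (\<Sum>m\<in>T. c m * \<phi> (x * a * Poly_Mapping.single m 1))"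
  proof (rule kv.functional_combination[OF finT])
    fix x assume x: "x \<in> homog_part k" and 0: "\<forall>m\<in>T. \<phi> (x * a * Poly_Mapping.single m 1) = 0"
    \<comment> \<open>If \<open>x\<close> pairs to zero with all multiples of \<open>a\<close>, then
      \<open>x a\<close> has no nonzero multiple in top degree, so it lies in \<open>W\<close>, and
      injectivity puts \<open>x\<close> into \<open>W\<close>.\<close>
    have xa: "x * a \<in> homog_part (k + d)" by (intro homog_part_mult x a)
    have "x * a \<in> W"
    proof (rule ccontr)
      assume "x * a \<notin> W"
      then obtain v where v: "v \<in> homog_part (Q - (k + d))" "x * a * v \<notin> W"
        using nonzero_multiple[OF xa] degree_le_top[OF xa] by blast
      then have v': "v \<in> homog_part (Q - k - d)" by (simp add: diff_diff_eq)
      have "\<phi> (x * a * v) = 0"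
        using expand[of "x * a" "Poly_Mapping.lookup v"] 0 unfolding T_sum[OF v', symmetric] by simp
      moreover have "x * a * v \<in> homog_part Q" using homog_part_mult[OF xa v(1)] by simp
      ultimately show False using v \<phi>_0 by blast
    qed
    then have "x \<in> W" using inj[OF x] by (simp add: mult.commute)
    then have "x * y \<in> W" using W_scale[of x y] by (simp add: mult.commute)
    then show "\<phi> (x * y) = 0" using homog_part_mult[OF x y] \<phi>_0 by simp
  qed (simp_all add: distrib_right mult.assoc \<phi>_add \<phi>_scale kv_subspace_homog_part)
  then obtain c where c: "\<And>x. x \<in> homog_part k \<Longrightarrow> \<phi> (x * y) = (\<Sum>m\<in>T. c m * \<phi> (x * a * Poly_Mapping.single m 1))"
    by blast
  define m where "m = (\<Sum>m\<in>T. Poly_Mapping.single m (c m))"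
  have m: "m \<in> homog_part (Q - k - d)" unfolding m_def by (rule T_homog)
  have am: "a * m \<in> homog_part (Q - k)" using homog_part_mult[OF a m] by simp
  have "y - a * m \<in> W"
  proof (rule ccontr)
    assume nW: "y - a * m \<notin> W"
    have h: "y - a * m \<in> homog_part (Q - k)" by (intro homog_part_diff y am)
    obtain v where v: "v \<in> homog_part (Q - (Q - k))" "(y - a * m) * v \<notin> W"
      using nonzero_multiple[OF h nW, of Q] k by auto
    \<comment> \<open>A nonzero difference in degree \<open>Q - k\<close> would pair nontrivially
      with some form of degree \<open>k\<close>, but \<open>m\<close> was built to match
      \<open>y\<close> in every such pairing.\<close>
    then have vk: "v \<in> homog_part k" by simp
    have "\<phi> (v * y) = \<phi> (v * a * m)" unfolding m_def expand c[OF vk] ..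
    moreover have "v * y = (y - a * m) * v + v * a * m" by (simp add: algebra_simps)
    ultimately have "\<phi> ((y - a * m) * v) = 0" by (simp add: \<phi>_add)
    moreover have "(y - a * m) * v \<in> homog_part Q" using homog_part_mult[OF h vk] by simp
    ultimately show False using v \<phi>_0 by blast
  qed
  with m show ?thesis by blast
qed

text \<open>Every monomial of degree \<open>p + 1\<close> is a variable times one of degree
  \<open>p\<close>, so preimages are obtained by multiplying with the variable and adding.\<close>

lemma mult_surjective_above:
  assumes a: "a \<in> homog_part d" and p0: "0 \<le> p0"
    and base: "\<And>y. y \<in> homog_part p0 \<Longrightarrow> \<exists>m \<in> homog_part (p0 - d). y - a * m \<in> W"
    and p: "p0 \<le> p" and y: "y \<in> homog_part p"
  shows "\<exists>m \<in> homog_part (p - d). y - a * m \<in> W"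
  using p y
proof (induction p arbitrary: y rule: int_ge_induct)
  case base
  then show ?case by (rule assms(3))
next
  case (step p)
  let ?P = "\<lambda>y. \<exists>m \<in> homog_part (p + 1 - d). y - a * m \<in> W"
  have P0: "?P 0" by (intro bexI[of _ 0]) (simp_all add: W_0)
  have P_add: "?P (y + y')" if y: "?P y" and y': "?P y'" for y y'
  proof -
    obtain m m' where m: "m \<in> homog_part (p + 1 - d)" "y - a * m \<in> W"
      and m': "m' \<in> homog_part (p + 1 - d)" "y' - a * m' \<in> W" using y y' by blast
    have "y + y' - a * (m + m') \<in> W"
      using W_add[OF m(2) m'(2)] by (simp add: algebra_simps)
    then show ?thesis using homog_part_add[OF m(1) m'(1)] by blast
  qed
  have P_single: "?P (Poly_Mapping.single t c)" if t: "mdeg t = p + 1" for t c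
  proof -
    have "t \<noteq> 0" using t step.hyps p0 by (auto simp: mdeg_def)
    then obtain v where "Poly_Mapping.lookup t v \<noteq> 0"
      by (metis lookup_zero poly_mapping_eqI)
    note eq = split_var[OF this]
    let ?t = "t - Poly_Mapping.single v 1"
    have "mdeg ?t = p" using arg_cong[OF eq, of mdeg] t by (simp add: mdeg_add mdeg_single)
    then have "Poly_Mapping.single ?t c \<in> homog_part p" using homog_part_single[of ?t c] by simp
    then obtain m where m: "m \<in> homog_part (p - d)" "Poly_Mapping.single ?t c - a * m \<in> W"
      using step.IH by blast
    have "pvar v * Poly_Mapping.single ?t c = Poly_Mapping.single t c"
      using eq by (simp add: mult_single)
    then have "Poly_Mapping.single t c - a * (pvar v * m) \<in> W"
      using W_scale[OF m(2), of "pvar v"] by (simp add: right_diff_distrib mult.left_commute)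
    moreover have "pvar v * m \<in> homog_part (p + 1 - d)"
      using homog_part_mult[OF pvar_homog m(1)] by (simp add: algebra_simps)
    ultimately show ?thesis by blast
  qed
  have "?P (\<Sum>t\<in>T. Poly_Mapping.single t (Poly_Mapping.lookup y t))" if "T \<subseteq> Poly_Mapping.keys y" for T
    using finite_subset[OF that finite_keys] that
  proof (induction T rule: finite_induct)
    case (insert t T)
    then have "mdeg t = p + 1" using step.prems by (auto simp: homog_part_iff in_keys_iff)
    then show ?case using insert by (simp add: P_add P_single)
  qed (use P0 in simp)
  from this[OF order_refl] show ?case by (simp only: sum_single_keys)
qed

end

section \<open>Quotients in HOL-Algebra\<close>

lemma type_algebra_simps [simp]:
  "carrier ring_of_type_algebra = UNIV"
  "x \<otimes>\<^bsub>ring_of_type_algebra\<^esub> y = x * y"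
  "x \<oplus>\<^bsub>ring_of_type_algebra\<^esub> y = x + y"
  "\<zero>\<^bsub>ring_of_type_algebra\<^esub> = 0" "\<one>\<^bsub>ring_of_type_algebra\<^esub> = 1"
  by (simp_all add: ring_of_type_algebra_def)

lemma type_algebra_minus:
  "x \<ominus>\<^bsub>ring_of_type_algebra\<^esub> y = x - (y :: 'a :: comm_ring_1)"
proof -
  interpret cring "ring_of_type_algebra :: 'a ring" by (rule cring_from_type_algebra)
  have "y \<oplus>\<^bsub>ring_of_type_algebra\<^esub> (\<ominus>\<^bsub>ring_of_type_algebra\<^esub> y) = \<zero>\<^bsub>ring_of_type_algebra\<^esub>"
    by (rule r_neg) simp
  then have "\<ominus>\<^bsub>ring_of_type_algebra\<^esub> y = - y"
    by (simp add: eq_neg_iff_add_eq_0 add.commute)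
  then show ?thesis by (simp add: a_minus_def)
qed

lemma ideal_type_algebra_iff:
  "ideal I (ring_of_type_algebra :: 'a :: comm_ring_1 ring) \<longleftrightarrow> idl.subspace I"
proof
  assume "ideal I (ring_of_type_algebra :: 'a ring)"
  then interpret ideal I "ring_of_type_algebra :: 'a ring" .
  show "idl.subspace I"
    using additive_subgroup.zero_closed[OF is_additive_subgroup]
      additive_subgroup.a_closed[OF is_additive_subgroup] I_l_closed
    by (intro idl.subspaceI) auto
next
  assume I: "idl.subspace I"
  interpret cring "ring_of_type_algebra :: 'a ring" by (rule cring_from_type_algebra)
  show "ideal I (ring_of_type_algebra :: 'a ring)"
  proof (rule idealI)
    show "subgroup I (add_monoid (ring_of_type_algebra :: 'a ring))"
    proof (rule add.subgroupI)
      fix a assume a: "a \<in> I"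
      have "\<ominus>\<^bsub>ring_of_type_algebra\<^esub> a = - a"
        using type_algebra_minus[of 0 a] by (simp add: a_minus_def)
      then show "\<ominus>\<^bsub>ring_of_type_algebra\<^esub> a \<in> I"
        using idl.subspace_neg[OF I a] by simp
    qed (use idl.subspace_0[OF I] idl.subspace_add[OF I] in auto)
    fix a x assume "a \<in> I"
    then show "x \<otimes>\<^bsub>ring_of_type_algebra\<^esub> a \<in> I" "a \<otimes>\<^bsub>ring_of_type_algebra\<^esub> x \<in> I"
      using idl.subspace_scale[OF I, of a x] by (simp_all add: mult.commute)
  qed (rule ring_axioms)
qed

lemma genideal_type_algebra:
  "Idl\<^bsub>ring_of_type_algebra\<^esub> G = idl.span (G :: 'a :: comm_ring_1 set)"
  unfolding genideal_def ideal_type_algebra_iff idl.span_def hull_def by (rule arg_cong) auto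

lemma quotient_facts:
  assumes "cring R" "ideal I R"
  shows "cring (R Quot I)"
    and "carrier (R Quot I) = (\<lambda>x. I +>\<^bsub>R\<^esub> x) ` carrier R"
    and "x \<in> carrier R \<Longrightarrow> y \<in> carrier R \<Longrightarrow>
      (I +>\<^bsub>R\<^esub> x) \<otimes>\<^bsub>R Quot I\<^esub> (I +>\<^bsub>R\<^esub> y) = I +>\<^bsub>R\<^esub> (x \<otimes>\<^bsub>R\<^esub> y)"
    and "x \<in> carrier R \<Longrightarrow> y \<in> carrier R \<Longrightarrow>
      (I +>\<^bsub>R\<^esub> x) \<ominus>\<^bsub>R Quot I\<^esub> (I +>\<^bsub>R\<^esub> y) = I +>\<^bsub>R\<^esub> (x \<ominus>\<^bsub>R\<^esub> y)"
    and "x \<in> carrier R \<Longrightarrow> y \<in> carrier R \<Longrightarrow>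
      I +>\<^bsub>R\<^esub> x = I +>\<^bsub>R\<^esub> y \<longleftrightarrow> x \<ominus>\<^bsub>R\<^esub> y \<in> I"
proof -
  interpret R: cring R by fact
  interpret I: ideal I R by fact
  show "cring (R Quot I)" by (rule I.quotient_is_cring[OF assms(1)])
  show "carrier (R Quot I) = (\<lambda>x. I +>\<^bsub>R\<^esub> x) ` carrier R"
    by (auto simp: FactRing_def A_RCOSETS_def')
  interpret h: ring_hom_ring R "R Quot I" "(+>\<^bsub>R\<^esub>) I"
    by (rule I.rcos_ring_hom_ring)
  assume x: "x \<in> carrier R" and y: "y \<in> carrier R"
  show "(I +>\<^bsub>R\<^esub> x) \<otimes>\<^bsub>R Quot I\<^esub> (I +>\<^bsub>R\<^esub> y) = I +>\<^bsub>R\<^esub> (x \<otimes>\<^bsub>R\<^esub> y)"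
    using x y by simp
  show "(I +>\<^bsub>R\<^esub> x) \<ominus>\<^bsub>R Quot I\<^esub> (I +>\<^bsub>R\<^esub> y) = I +>\<^bsub>R\<^esub> (x \<ominus>\<^bsub>R\<^esub> y)"
    using x y by (simp add: a_minus_def)
  show "I +>\<^bsub>R\<^esub> x = I +>\<^bsub>R\<^esub> y \<longleftrightarrow> x \<ominus>\<^bsub>R\<^esub> y \<in> I"
    using R.quotient_eq_iff_same_a_r_cos[OF assms(2) x y] by simp
qed

text \<open>The abstract \<open>\<pi>\<close> covers the map to \<open>S/J\<close> and the composite
  to \<open>B/(l)\<close> alike. The inclusion \<open>a\<close> turns the demanded equality of image
  and target into solvability of congruences.\<close>

lemma mult_surj_iff:
  fixes \<pi> :: "'a :: comm_ring_1 \<Rightarrow> 'b"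
  assumes mult: "\<And>x y. \<pi> (x * y) = \<pi> x \<otimes>\<^bsub>R\<^esub> \<pi> y"
    and eq: "\<And>x y. \<pi> x = \<pi> y \<longleftrightarrow> x - y \<in> C"
    and a: "\<And>x. x \<in> V \<Longrightarrow> a * x \<in> U"
  shows "mult_surj R (\<pi> a) (\<pi> ` V) (\<pi> ` U) \<longleftrightarrow> (\<forall>y\<in>U. \<exists>x\<in>V. y - a * x \<in> C)"
proof -
  have "(\<lambda>x. \<pi> a \<otimes>\<^bsub>R\<^esub> x) ` \<pi> ` V = (\<lambda>x. \<pi> (a * x)) ` V"
    by (simp add: image_image mult)
  moreover have "(\<lambda>x. \<pi> (a * x)) ` V \<subseteq> \<pi> ` U" using a by auto
  ultimately have "mult_surj R (\<pi> a) (\<pi> ` V) (\<pi> ` U) \<longleftrightarrow> \<pi> ` U \<subseteq> (\<lambda>x. \<pi> (a * x)) ` V"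
    by (auto simp: mult_surj_def)
  then show ?thesis by (simp add: image_subset_iff image_iff eq)
qed

lemma mult_inj_iff:
  fixes \<pi> :: "'a :: comm_ring_1 \<Rightarrow> 'b"
  assumes mult: "\<And>x y. \<pi> (x * y) = \<pi> x \<otimes>\<^bsub>R\<^esub> \<pi> y"
    and eq: "\<And>x y. \<pi> x = \<pi> y \<longleftrightarrow> x - y \<in> C"
    and V: "0 \<in> V" "\<And>x y. x \<in> V \<Longrightarrow> y \<in> V \<Longrightarrow> x - y \<in> V"
  shows "mult_inj R (\<pi> a) (\<pi> ` V) \<longleftrightarrow> (\<forall>x\<in>V. a * x \<in> C \<longrightarrow> x \<in> C)"
proof -
  have "mult_inj R (\<pi> a) (\<pi> ` V) \<longleftrightarrow> (\<forall>x\<in>V. \<forall>y\<in>V. a * (x - y) \<in> C \<longrightarrow> x - y \<in> C)"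
    by (simp add: mult_inj_def inj_on_def eq right_diff_distrib flip: mult)
  also have "\<dots> \<longleftrightarrow> (\<forall>x\<in>V. a * x \<in> C \<longrightarrow> x \<in> C)"
    using V by (metis diff_zero)
  finally show ?thesis .
qed

section \<open>Cosets of an ideal and the double quotient\<close>

context
  fixes I :: "'a :: comm_ring_1 set"
  assumes I: "idl.subspace I"
begin

lemma type_quotient_ideal: "ideal I (ring_of_type_algebra :: 'a ring)"
  using I by (simp add: ideal_type_algebra_iff)

lemma type_quotient_cring: "cring ((ring_of_type_algebra :: 'a ring) Quot I)"
  and type_quotient_carrier: "carrier (ring_of_type_algebra Quot I) = Set.range (\<lambda>x. I +>\<^bsub>ring_of_type_algebra\<^esub> x)"
  and type_quotient_mult: "(I +>\<^bsub>ring_of_type_algebra\<^esub> x) \<otimes>\<^bsub>ring_of_type_algebra Quot I\<^esub> (I +>\<^bsub>ring_of_type_algebra\<^esub> y)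
    = I +>\<^bsub>ring_of_type_algebra\<^esub> (x * y)"
  and type_quotient_minus: "(I +>\<^bsub>ring_of_type_algebra\<^esub> x) \<ominus>\<^bsub>ring_of_type_algebra Quot I\<^esub> (I +>\<^bsub>ring_of_type_algebra\<^esub> y)
    = I +>\<^bsub>ring_of_type_algebra\<^esub> (x - y)"
  and type_quotient_eq: "I +>\<^bsub>ring_of_type_algebra\<^esub> x = I +>\<^bsub>ring_of_type_algebra\<^esub> y \<longleftrightarrow> x - y \<in> I"
  using quotient_facts[OF cring_from_type_algebra type_quotient_ideal]
  by (simp_all add: type_algebra_minus)

lemma nonzerodivisor_type_quotient:
  "nonzerodivisor (ring_of_type_algebra Quot I) (I +>\<^bsub>ring_of_type_algebra\<^esub> a) \<longleftrightarrow> regular_mod I a"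
proof -
  interpret cring "ring_of_type_algebra Quot I" by (rule type_quotient_cring)
  have "\<zero>\<^bsub>ring_of_type_algebra Quot I\<^esub>
      = (I +>\<^bsub>ring_of_type_algebra\<^esub> 0) \<ominus>\<^bsub>ring_of_type_algebra Quot I\<^esub> (I +>\<^bsub>ring_of_type_algebra\<^esub> 0)"
    by (simp add: type_quotient_carrier a_minus_def r_neg)
  also have "\<dots> = I +>\<^bsub>ring_of_type_algebra\<^esub> 0" by (simp only: type_quotient_minus diff_self)
  finally show ?thesis
    by (auto simp: nonzerodivisor_def regular_mod_def type_quotient_carrier type_quotient_mult type_quotient_eq)
qed

text \<open>The third isomorphism theorem reduced to what the maps use: the composite of both
  projections is multiplicative and has kernel \<open>I + (l)\<close>.\<close>

lemma iterated_quotient: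
  fixes l :: 'a
  defines "B \<equiv> ring_of_type_algebra Quot I"
  defines "L \<equiv> PIdl\<^bsub>B\<^esub> (I +>\<^bsub>ring_of_type_algebra\<^esub> l)"
  defines "\<pi> \<equiv> \<lambda>x. L +>\<^bsub>B\<^esub> (I +>\<^bsub>ring_of_type_algebra\<^esub> x)"
  shows "\<pi> (x * y) = \<pi> x \<otimes>\<^bsub>B Quot L\<^esub> \<pi> y"
    and "\<pi> x = \<pi> y \<longleftrightarrow> (\<exists>k. x - y - k * l \<in> I)"
proof -
  interpret B: cring B unfolding B_def by (rule type_quotient_cring)
  have carrier: "I +>\<^bsub>ring_of_type_algebra\<^esub> x \<in> carrier B" for x
    by (simp add: B_def type_quotient_carrier)
  have L: "ideal L B" unfolding L_def by (rule B.cgenideal_ideal[OF carrier])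
  show "\<pi> (x * y) = \<pi> x \<otimes>\<^bsub>B Quot L\<^esub> \<pi> y"
    unfolding \<pi>_def quotient_facts(3)[OF B.is_cring L carrier carrier]
    by (simp add: B_def type_quotient_mult)
  have "\<pi> x = \<pi> y \<longleftrightarrow> (I +>\<^bsub>ring_of_type_algebra\<^esub> (x - y)) \<in> L"
    unfolding \<pi>_def quotient_facts(5)[OF B.is_cring L carrier carrier]
    by (simp add: B_def type_quotient_minus)
  also have "L = (\<lambda>z. z \<otimes>\<^bsub>B\<^esub> (I +>\<^bsub>ring_of_type_algebra\<^esub> l)) ` carrier B"
    unfolding L_def cgenideal_def by blast
  also have "\<dots> = Set.range (\<lambda>k. I +>\<^bsub>ring_of_type_algebra\<^esub> (k * l))"
    by (simp add: B_def type_quotient_carrier type_quotient_mult image_image)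
  also have "I +>\<^bsub>ring_of_type_algebra\<^esub> (x - y) \<in> \<dots> \<longleftrightarrow> (\<exists>k. x - y - k * l \<in> I)"
    by (simp add: image_iff type_quotient_eq)
  finally show "\<pi> x = \<pi> y \<longleftrightarrow> (\<exists>k. x - y - k * l \<in> I)" .
qed

end

section \<open>Lefschetz-type multiplication maps\<close>

text \<open>A congruence \<open>y = a x + b k\<close> modulo \<open>G\<close> can be read as
  solvability for either factor; only the other cofactor has to be made homogeneous.\<close>

lemma graded_exchange:
  fixes a b y :: "('v :: finite, 'k :: comm_ring_1) mpoly"
  assumes G: "\<And>h. h \<in> G \<Longrightarrow> \<exists>e. h \<in> homog_part e"
    and a: "a \<in> homog_part \<alpha>" and b: "b \<in> homog_part \<beta>"
    and y: "y \<in> homog_part p"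
    and ex: "\<exists>x\<in>homog_part (p - \<alpha>). y - a * x \<in> idl.span (insert b G)"
  shows "\<exists>x\<in>homog_part (p - \<beta>). y - b * x \<in> idl.span (insert a G)"
proof -
  obtain x where x: "x \<in> homog_part (p - \<alpha>)" "y - a * x \<in> idl.span (insert b G)"
    using ex by blast
  then obtain k where k: "y - a * x - k * b \<in> idl.span G" by (auto simp: idl.span_insert)
  have ax: "a * x \<in> homog_part p" using homog_part_mult[OF a x(1)] by simp
  have "y - a * x - hcomp (p - \<beta>) k * b \<in> idl.span G"
    using hcomp_span[OF G k, of p]
    by (simp add: hcomp_diff hcomp_homog[OF y] hcomp_homog[OF ax] hcomp_mult[OF b])
  then have "y - b * hcomp (p - \<beta>) k - x * a \<in> idl.span G"
    by (simp add: algebra_simps)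
  then show ?thesis by (intro bexI[of _ "hcomp (p - \<beta>) k"]) (auto simp: idl.span_insert)
qed

theorem theorem2p6:
  fixes n :: nat
    and d :: "nat \<Rightarrow> nat"
    and f :: "nat \<Rightarrow> ('v :: finite, 'k :: field_char_0) mpoly"
    and l :: "('v, 'k) mpoly"
    and S :: "('v, 'k) mpoly ring"
    and J I W :: "('v, 'k) mpoly set"
    and SJ B :: "('v, 'k) mpoly set ring"
    and L :: "('v, 'k) mpoly set set"
    and Bl :: "('v, 'k) mpoly set set ring"
    and SJ_part B_part :: "int \<Rightarrow> ('v, 'k) mpoly set set"
    and Bl_part :: "int \<Rightarrow> ('v, 'k) mpoly set set set"
    and f0_Bl :: "('v, 'k) mpoly set set"
    and l_SJ l_B :: "('v, 'k) mpoly set"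
    and q :: int
    and A :: "int \<Rightarrow> bool"
  assumes num_vars: "CARD('v) = Suc n"
    and S: "S = PolyRing"
    and forms: "\<And>i. i \<le> n \<Longrightarrow> f i \<in> homog_part (int (d i)) \<and> f i \<noteq> 0"
    and reg: "regular_sequence S n f"
    and J: "J = Idl\<^bsub>S\<^esub> (f ` {0..n})"
    and SJ: "SJ = S Quot J"
    and SJ_part: "\<And>p. SJ_part p = quot_image S J (homog_part p)"
    and I: "I = Idl\<^bsub>S\<^esub> (f ` {1..n})"
    and B: "B = S Quot I"
    and B_part: "\<And>p. B_part p = quot_image S I (homog_part p)"
    and linear: "l \<in> homog_part 1"
    and l_SJ: "l_SJ = J +>\<^bsub>S\<^esub> l"
    and l_B: "l_B = I +>\<^bsub>S\<^esub> l"
    and l_reg: "nonzerodivisor B l_B"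
    and L: "L = PIdl\<^bsub>B\<^esub> l_B"
    and Bl: "Bl = B Quot L"
    and Bl_part: "\<And>p. Bl_part p = quot_image B L (B_part p)"
    and f0_Bl: "f0_Bl = L +>\<^bsub>B\<^esub> (I +>\<^bsub>S\<^esub> f 0)"
    and W: "W = Idl\<^bsub>S\<^esub> (insert l (f ` {1..n}))"
    and q: "q = (\<Sum>i = 1..n. (int (d i) - 1))"
    and A: "\<And>k. A k \<longleftrightarrow>
      (PIdl\<^bsub>S\<^esub> (f 0) \<inter> homog_part (int (d 0) + k)) \<inter> (W \<inter> homog_part (int (d 0) + k))
        = (\<lambda>g. f 0 \<otimes>\<^bsub>S\<^esub> g) ` (W \<inter> homog_part k)"
  shows
    "(\<forall>p :: int.
        mult_surj Bl f0_Bl (Bl_part (p - int (d 0))) (Bl_part p) \<longleftrightarrow>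
        mult_surj SJ l_SJ (SJ_part (p - 1)) (SJ_part p)) \<and>
     (\<forall>k :: int. 0 \<le> k \<and> k < q \<and> A k \<longrightarrow>
        (\<forall>p \<ge> q - k.
           mult_surj Bl f0_Bl (Bl_part (p - int (d 0))) (Bl_part p) \<and>
           mult_surj SJ l_SJ (SJ_part (p - 1)) (SJ_part p))) \<and>
     (\<forall>r :: int.
        mult_inj Bl f0_Bl (Bl_part r) \<longrightarrow>
        mult_inj SJ l_SJ (SJ_part (r + int (d 0) - 1))) \<and>
     (\<forall>k :: int. 0 \<le> k \<and> k < q \<and> A k \<longrightarrow>
        (\<forall>r. r \<le> k \<or> r > q \<longrightarrow>
           mult_inj Bl f0_Bl (Bl_part r) \<and>
           mult_inj SJ l_SJ (SJ_part (r + int (d 0) - 1))))"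
proof -
  let ?S = "ring_of_type_algebra :: ('v, 'k) mpoly ring"
  define G where "G = f ` {1..n}"
  have f_homog: "f i \<in> homog_part (int (d i))" if "i \<le> n" for i
    using forms[OF that] by simp
  have G_homog: "\<exists>e. h \<in> homog_part e" if "h \<in> G" for h
  proof -
    from that obtain i where "h = f i" "i \<le> n" by (auto simp: G_def)
    then show ?thesis using f_homog[of i] by auto
  qed
  have f0: "f 0 \<in> homog_part (int (d 0))" "f 0 \<noteq> 0"
    using forms[of 0] by auto
  have I_eq: "I = idl.span G" and W_eq: "W = idl.span (insert l G)"
    unfolding I W S genideal_type_algebra G_def by (rule refl)+
  have "f ` {0..n} = insert (f 0) G"
    unfolding G_def by (subst atLeastAtMost_insertL[of 0 n, symmetric]) auto
  then have J_eq: "J = idl.span (insert (f 0) G)"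
    unfolding J S genideal_type_algebra by simp
  have I_sub: "idl.subspace I" and J_sub: "idl.subspace J" and W_sub: "idl.subspace W"
    by (simp_all add: I_eq J_eq W_eq)
  have l_regular: "regular_mod (idl.span G) l"
    using l_reg by (simp add: B l_B S nonzerodivisor_type_quotient[OF I_sub] flip: I_eq)

  \<comment> \<open>A nonzero form of degree 0 is a unit, contradicting that a regular sequence
    generates a proper ideal.\<close>
  have d_pos: "1 \<le> d i" if i: "i \<in> {1..n}" for i
  proof (rule ccontr)
    assume "\<not> 1 \<le> d i"
    then have "d i = 0" by simp
    then have "f i \<in> homog_part 0" "f i \<noteq> 0" using forms[of i] i by simp_all
    define c where "c = Poly_Mapping.lookup (f i) 0"
    have fc: "f i = Poly_Mapping.single 0 c"
      using \<open>f i \<in> homog_part 0\<close>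
      by (intro poly_mapping_eqI) (auto simp: homog_part_iff mdeg_eq_0_iff c_def lookup_single when_def)
    then have "c \<noteq> 0" using \<open>f i \<noteq> 0\<close> by auto
    then have "Poly_Mapping.single 0 (inverse c) * f i = 1"
      by (simp add: fc mult_single)
    moreover have "Poly_Mapping.single 0 (inverse c) * f i \<in> I"
      unfolding I_eq using i by (intro idl.span_scale idl.span_base) (auto simp: G_def)
    ultimately have "x \<in> I" for x
      using idl.subspace_scale[OF I_sub, of 1 x] by simp
    then have "I = UNIV" by blast
    then show False using reg unfolding regular_sequence_def S I by simp
  qed
  have f_regular: "regular_mod (idl.span (f ` {1..<i})) (f i)" if "i \<in> {1..n}" for i
    using reg that unfolding regular_sequence_def S genideal_type_algebra
    by (simp add: nonzerodivisor_type_quotient)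

  \<comment> \<open>The linear form comes last, after \<open>f 1\<close>, ..., \<open>f n\<close>
    shifted to start at index 0; its regularity is known modulo all the others.\<close>
  define g where "g i = (if i < n then f (Suc i) else l)" for i
  define e where "e i = (if i < n then d (Suc i) else 1)" for i
  have g_image: "g ` {..<i} = f ` {1..<Suc i}" if "i \<le> n" for i
  proof -
    have "g ` {..<i} = f ` Suc ` {..<i}"
      using that unfolding image_image by (intro image_cong) (auto simp: g_def)
    then show ?thesis by (simp add: image_Suc_lessThan atLeastLessThanSuc_atLeastAtMost)
  qed
  have g_n: "g ` {..<n} = G"
    using g_image[of n] by (simp add: G_def atLeastLessThanSuc_atLeastAtMost)
  interpret ci: homogeneous_complete_intersection g e
  proof
    fix i assume "i < CARD('v)"
    then have i: "i \<le> n" by (simp add: num_vars)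
    show "g i \<in> homog_part (int (e i))"
      using linear f_homog[of "Suc i"] by (simp add: g_def e_def)
    show "1 \<le> e i" using d_pos[of "Suc i"] by (simp add: e_def)
    show "regular_mod (idl.span (g ` {..<i})) (g i)"
    proof (cases "i < n")
      case True
      then show ?thesis using f_regular[of "Suc i"] g_image[OF i] by (simp add: g_def)
    next
      case False
      then have "i = n" using i by simp
      then show ?thesis using l_regular by (simp only: g_n) (simp add: g_def)
    qed
  qed
  have "g ` {..<CARD('v)} = insert l G"
    unfolding num_vars lessThan_Suc image_insert g_n by (simp add: g_def)
  then have ciW: "ci.W = W" by (simp add: ci.W_def W_eq)
  \<comment> \<open>The linear form has degree 1 and contributes nothing to the top degree.\<close>
  have "(\<Sum>i<CARD('v). e i - 1) = (\<Sum>i<n. d (Suc i) - 1)"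
    by (simp add: num_vars e_def)
  also have "\<dots> = (\<Sum>i = 1..n. d i - 1)"
    by (rule sum.reindex_bij_witness[of _ "\<lambda>i. i - 1" Suc]) auto
  \<comment> \<open>Positivity of the degrees makes subtraction of naturals agree with the integer
    differences in \<open>q\<close>.\<close>
  also have "int \<dots> = q"
    unfolding q of_nat_sum using d_pos by (intro sum.cong) (auto simp: of_nat_diff)
  finally have ciQ: "ci.Q = q" by (simp only: ci.Q_def)

  define \<pi> where "\<pi> x = L +>\<^bsub>B\<^esub> (I +>\<^bsub>?S\<^esub> x)" for x
  have \<pi>_mult: "\<pi> (x * y) = \<pi> x \<otimes>\<^bsub>Bl\<^esub> \<pi> y" for x y
    using iterated_quotient(1)[OF I_sub, of l x y] by (simp add: \<pi>_def Bl L l_B B S)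
  have \<pi>_eq: "\<pi> x = \<pi> y \<longleftrightarrow> x - y \<in> W" for x y
    using iterated_quotient(2)[OF I_sub, of l x y]
    by (simp add: \<pi>_def L l_B B S W_eq I_eq idl.span_insert)
  have Bl_part_eq: "Bl_part p = \<pi> ` homog_part p" for p
    unfolding Bl_part B_part quot_image_def image_image \<pi>_def S by (rule refl)
  have f0_Bl_eq: "f0_Bl = \<pi> (f 0)" unfolding f0_Bl \<pi>_def S by (rule refl)
  have SJ_part_eq: "SJ_part p = (\<lambda>x. J +>\<^bsub>?S\<^esub> x) ` homog_part p" for p
    unfolding SJ_part quot_image_def S by (rule refl)
  have f0_mult: "f 0 * x \<in> homog_part p" if "x \<in> homog_part (p - int (d 0))" for x p
    using homog_part_mult[OF f0(1) that] by simp
  have l_mult: "l * x \<in> homog_part p" if "x \<in> homog_part (p - 1)" for x p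
    using homog_part_mult[OF linear that] by simp

  \<comment> \<open>The multiplication maps as congruences in the polynomial ring\<close>
  have surj_Bl: "mult_surj Bl f0_Bl (Bl_part (p - int (d 0))) (Bl_part p)
      \<longleftrightarrow> (\<forall>y\<in>homog_part p. \<exists>x\<in>homog_part (p - int (d 0)). y - f 0 * x \<in> W)" for p
    unfolding Bl_part_eq f0_Bl_eq by (rule mult_surj_iff[OF \<pi>_mult \<pi>_eq f0_mult])
  have surj_SJ: "mult_surj SJ l_SJ (SJ_part (p - 1)) (SJ_part p)
      \<longleftrightarrow> (\<forall>y\<in>homog_part p. \<exists>x\<in>homog_part (p - 1). y - l * x \<in> J)" for p
    unfolding SJ_part_eq l_SJ SJ S
    by (rule mult_surj_iff[OF type_quotient_mult[OF J_sub, symmetric] type_quotient_eq[OF J_sub] l_mult])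
  have inj_Bl: "mult_inj Bl f0_Bl (Bl_part r) \<longleftrightarrow> (\<forall>x\<in>homog_part r. f 0 * x \<in> W \<longrightarrow> x \<in> W)" for r
    unfolding Bl_part_eq f0_Bl_eq by (rule mult_inj_iff[OF \<pi>_mult \<pi>_eq homog_part_0 homog_part_diff])
  have inj_SJ: "mult_inj SJ l_SJ (SJ_part r) \<longleftrightarrow> (\<forall>x\<in>homog_part r. l * x \<in> J \<longrightarrow> x \<in> J)" for r
    unfolding SJ_part_eq l_SJ SJ S
    by (rule mult_inj_iff[OF type_quotient_mult[OF J_sub, symmetric] type_quotient_eq[OF J_sub]
          homog_part_0 homog_part_diff])

  \<comment> \<open>Comparison of the two multiplication maps\<close>
  have surj_iff: "mult_surj Bl f0_Bl (Bl_part (p - int (d 0))) (Bl_part p)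
      \<longleftrightarrow> mult_surj SJ l_SJ (SJ_part (p - 1)) (SJ_part p)" for p
    unfolding surj_Bl surj_SJ W_eq J_eq
    using graded_exchange[OF G_homog f0(1) linear] graded_exchange[OF G_homog linear f0(1)] by blast

  have inj_imp: "mult_inj SJ l_SJ (SJ_part (r + int (d 0) - 1))"
    if inj: "mult_inj Bl f0_Bl (Bl_part r)" for r
    unfolding inj_SJ
  proof (intro ballI impI)
    fix x assume x: "x \<in> homog_part (r + int (d 0) - 1)" and "l * x \<in> J"
    then have "l * x - f 0 * 0 \<in> idl.span (insert (f 0) G)" by (simp add: J_eq)
    then obtain k where k: "l * x - k * f 0 \<in> idl.span G" by (auto simp: idl.span_insert)
    have lx: "l * x \<in> homog_part (r + int (d 0))" by (rule l_mult[OF x])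
    \<comment> \<open>Only the component of degree \<open>r\<close> of the cofactor of
      \<open>f 0\<close> matters, and this is the degree in which injectivity is given.\<close>
    define k' where "k' = hcomp r k"
    have k'_homog: "k' \<in> homog_part r" by (simp add: k'_def)
    have k': "l * x - k' * f 0 \<in> idl.span G"
      using hcomp_span[OF G_homog k, of "r + int (d 0)"]
      by (simp add: hcomp_diff hcomp_homog[OF lx] hcomp_mult[OF f0(1)] k'_def)
    have "f 0 * k' - x * l \<in> idl.span G"
      using idl.span_neg[OF k'] by (simp add: mult.commute)
    then have "f 0 * k' \<in> W" by (auto simp: W_eq idl.span_insert)
    then have "k' \<in> W" using inj k'_homog by (simp add: inj_Bl)
    then obtain m where m: "k' - m * l \<in> idl.span G" by (auto simp: W_eq idl.span_insert)
    \<comment> \<open>Since \<open>k'\<close> is \<open>m l\<close> modulo \<open>G\<close>, the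
      relation becomes \<open>l (x - m f_0) = 0\<close> modulo \<open>G\<close>, and
      \<open>l\<close> cancels.\<close>
    have "l * x - k' * f 0 + f 0 * (k' - m * l) \<in> idl.span G"
      by (intro idl.span_add idl.span_scale k' m)
    then have "l * (x - m * f 0) \<in> idl.span G" by (simp add: algebra_simps)
    then have "x - m * f 0 \<in> idl.span G" by (rule regular_modD[OF l_regular])
    then show "x \<in> J" by (auto simp: J_eq idl.span_insert)
  qed

  \<comment> \<open>Consequences of (A)\<close>
  have A_inj: "w \<in> W" if A_k: "A k" and w: "w \<in> homog_part k" "f 0 * w \<in> W" for k w
  proof -
    have "f 0 * w \<in> PIdl\<^bsub>?S\<^esub> (f 0)"
      by (auto simp: cgenideal_def mult.commute)
    moreover have "f 0 * w \<in> homog_part (int (d 0) + k)" by (rule homog_part_mult[OF f0(1) w(1)])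
    ultimately have "f 0 * w \<in> (\<lambda>g. f 0 * g) ` (W \<inter> homog_part k)"
      using A_k w(2) unfolding A S type_algebra_simps by blast
    \<comment> \<open>By (A) the product has a second factorisation with cofactor in
      \<open>W\<close>; cancelling \<open>f 0\<close> in the domain identifies the two
      cofactors.\<close>
    then obtain w' where w': "w' \<in> W" "f 0 * w = f 0 * w'" by blast
    then have "f 0 * (w - w') = 0" by (simp add: right_diff_distrib)
    then have "w - w' = 0" using f0(2) by (rule mpoly_mult_eq_0)
    then show ?thesis using w'(1) by simp
  qed

  \<comment> \<open>Duality gives surjectivity onto degree \<open>q - k\<close>, which is positive,
    and it propagates to all higher degrees.\<close>
  have surj: "mult_surj Bl f0_Bl (Bl_part (p - int (d 0))) (Bl_part p)"
    if k: "0 \<le> k" "k < q" "A k" and p: "q - k \<le> p" for k p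
    unfolding surj_Bl
  proof
    fix y :: "('v, 'k) mpoly" assume "y \<in> homog_part p"
    with p show "\<exists>x\<in>homog_part (p - int (d 0)). y - f 0 * x \<in> W"
      using ci.mult_surjective_above[OF f0(1), of "q - k" p y]
        ci.mult_surjective_dual[OF f0(1), of k] A_inj[OF k(3)] k(1,2)
      unfolding ciW ciQ by auto
  qed
  \<comment> \<open>For \<open>r \<le> k\<close> injectivity descends from degree \<open>k\<close>;
    for \<open>r > q\<close> the source is zero.\<close>
  have inj: "mult_inj Bl f0_Bl (Bl_part r)"
    if k: "0 \<le> k" "k < q" "A k" and r: "r \<le> k \<or> q < r" for k r
    unfolding inj_Bl
    using r ci.mult_injective_below[of k "f 0" r] A_inj[OF k(3)] k(2) ci.above_top_in_W[of r]
    unfolding ciW ciQ by auto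

  show ?thesis using surj_iff surj inj inj_imp by blast
qed

end
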